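(* For any permutation $w\in\mathfrak{S}_n$, the polynomial identity $$\sum_{u\in[e,w]}q^{a\ell(u,w)}=(-q)^n\chi_{G_w}(-q^{-1})$$ holds if and only if $w$ avoids the patterns $4231$, $35142$, $42513$ and $351624$.
   Context: Permutations act on the right on $[n]$ and $uw$ means "first $u$, then $w$". $[e,w]$ is the set of $u\le w$ in the Bruhat order. $T$ is the set of transpositions and $\ell$ the Coxeter length with respect to adjacent transpositions. The Bruhat graph is the directed graph on $\mathfrak{S}_n$ with an edge $x\to tx$ whenever $t\in T$ and $\ell(x)<\ell(tx)$; $a\ell(u,w)$ is the length of a shortest directed path from $u$ to $w$. The inversion graph $G_w$ has vertex set $[n]$, with $\{i,j\}$ ($i<j$) an edge iff $iw>jw$; $\chi_{G_w}(t)$ is its chromatic polynomial. Pattern avoidance: for $p\in\mathfrak{S}_m$ in one-line notation, $w$ avoids $p$ if there are no $i_1<\cdots<i_m$ with $i_aw<i_bw\iff ap<bp$ for all $a,b$. *)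

theory Defs
  imports
    "HOL-Combinatorics.Permutations"
    "HOL-Library.FuncSet"
    "HOL-Computational_Algebra.Polynomial"
    "HOL-Computational_Algebra.Fraction_Field"
begin

section \<open>The symmetric group, Coxeter length and the Bruhat graph\<close>

definition sym_group :: "nat \<Rightarrow> (nat \<Rightarrow> nat) set" where
  "sym_group n = {w. w permutes {1..n}}"

text \<open>Permutations act on the right, so the image \<open>i w\<close> is written \<open>w i\<close> here and the
  product \<open>u w\<close> (first \<open>u\<close>, then \<open>w\<close>) is the composition \<open>w \<circ> u\<close>.\<close>

definition perm_mult :: "(nat \<Rightarrow> nat) \<Rightarrow> (nat \<Rightarrow> nat) \<Rightarrow> nat \<Rightarrow> nat"  (infixl "\<cdot>" 70) where
  "u \<cdot> w = w \<circ> u"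

definition transpositions :: "nat \<Rightarrow> (nat \<Rightarrow> nat) set" where
  "transpositions n = {transpose i j | i j. 1 \<le> i \<and> i < j \<and> j \<le> n}"

definition adjacent_transpositions :: "nat \<Rightarrow> (nat \<Rightarrow> nat) set" where
  "adjacent_transpositions n = {transpose i (i + 1) | i. 1 \<le> i \<and> i + 1 \<le> n}"

definition cox_length :: "nat \<Rightarrow> (nat \<Rightarrow> nat) \<Rightarrow> nat" where
  "cox_length n w = (LEAST k. \<exists>ss. length ss = k \<and> set ss \<subseteq> adjacent_transpositions n
                                \<and> w = foldr (\<cdot>) ss id)"

definition bruhat_graph :: "nat \<Rightarrow> ((nat \<Rightarrow> nat) \<times> (nat \<Rightarrow> nat)) set" where
  "bruhat_graph n = {(x, t \<cdot> x) | x t. x \<in> sym_group n \<and> t \<in> transpositions n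
                                \<and> cox_length n x < cox_length n (t \<cdot> x)}"

definition bruhat_le :: "nat \<Rightarrow> (nat \<Rightarrow> nat) \<Rightarrow> (nat \<Rightarrow> nat) \<Rightarrow> bool" where
  "bruhat_le n u w \<longleftrightarrow> u \<in> sym_group n \<and> w \<in> sym_group n \<and> (u, w) \<in> (bruhat_graph n)\<^sup>*"

definition lower_interval :: "nat \<Rightarrow> (nat \<Rightarrow> nat) \<Rightarrow> (nat \<Rightarrow> nat) set" where
  "lower_interval n w = {u. bruhat_le n u w}"

text \<open>The length of a shortest directed path from \<open>u\<close> to \<open>w\<close>; it is only meaningful if there
  is such a path, i.e. if \<open>bruhat_le n u w\<close>.\<close>

definition abs_length :: "nat \<Rightarrow> (nat \<Rightarrow> nat) \<Rightarrow> (nat \<Rightarrow> nat) \<Rightarrow> nat" where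
  "abs_length n u w = (LEAST k. (u, w) \<in> bruhat_graph n ^^ k)"


section \<open>Chromatic polynomials\<close>

text \<open>A simple graph is given by its vertex set and its set of two-element edges.\<close>

definition proper_colorings :: "'a set \<Rightarrow> 'a set set \<Rightarrow> nat \<Rightarrow> ('a \<Rightarrow> nat) set" where
  "proper_colorings V E k = {c \<in> V \<rightarrow>\<^sub>E {..<k}. \<forall>x\<in>V. \<forall>y\<in>V. {x, y} \<in> E \<longrightarrow> c x \<noteq> c y}"

definition chromatic_poly :: "'a set \<Rightarrow> 'a set set \<Rightarrow> int poly" where
  "chromatic_poly V E = (THE p. \<forall>k. poly p (int k) = int (card (proper_colorings V E k)))"

text \<open>The description is proper: such a polynomial exists for every finite graph (by
  deletion and contraction of a list of constraints) and is unique.\<close>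

lemma ex_poly_card_constrained_colorings:
  assumes "finite V" "set L \<subseteq> V \<times> V"
  shows "\<exists>p::int poly. \<forall>k. poly p (int k) =
           int (card {c \<in> V \<rightarrow>\<^sub>E {..<k}. \<forall>(x, y) \<in> set L. c x \<noteq> c y})"
  using assms
proof (induction "length L" arbitrary: V L)
  case 0
  then have "\<forall>k. poly (monom 1 (card V)) (int k) =
           int (card {c \<in> V \<rightarrow>\<^sub>E {..<k}. \<forall>(x, y) \<in> set L. c x \<noteq> c y})"
    by (simp add: poly_monom card_funcsetE)
  then show ?case by blast
next
  case (Suc m)
  then obtain x y L' where L: "L = (x, y) # L'" by (cases L) auto
  have xy: "x \<in> V" "y \<in> V" and L': "set L' \<subseteq> V \<times> V" and m: "m = length L'"
    using Suc L by auto
  let ?C = "\<lambda>V L k. {c \<in> V \<rightarrow>\<^sub>E {..<k::nat}. \<forall>(x, y) \<in> set L. c x \<noteq> c y}"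
  have fin: "finite (?C V L' k)" for k
    by (rule finite_subset[of _ "V \<rightarrow>\<^sub>E {..<k}"]) (use Suc.prems(1) in \<open>auto intro: finite_PiE\<close>)
  obtain p :: "int poly" where p: "\<And>k. poly p (int k) = int (card (?C V L' k))"
    using Suc.hyps(1)[OF m Suc.prems(1) L'] by blast
  show ?case
  proof (cases "x = y")
    case True
    then have "\<forall>k. poly 0 (int k) = int (card (?C V L k))" using L by simp
    then show ?thesis by blast
  next
    case False
    define r where "r = (\<lambda>z. if z = y then x else z)"
    define M where "M = map (map_prod r r) L'"
    let ?V = "V - {y}"
    have M: "set M \<subseteq> ?V \<times> ?V"
      using L' xy False by (auto simp: M_def r_def split: if_splits)
    have "m = length M" "finite ?V" using m Suc.prems(1) by (auto simp: M_def)
    then obtain p' :: "int poly" where p': "\<And>k. poly p' (int k) = int (card (?C ?V M k))"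
      using Suc.hyps(1)[OF _ _ M] by blast
    have eq: "card (?C V L k) + card (?C ?V M k) = card (?C V L' k)" for k
    proof -
      let ?B = "{c \<in> ?C V L' k. c x = c y}"
      have "bij_betw (\<lambda>c. restrict c ?V) ?B (?C ?V M k)"
      proof (rule bij_betw_byWitness[where f' = "\<lambda>c. restrict (c \<circ> r) V"])
        show "\<forall>c\<in>?B. restrict (restrict c ?V \<circ> r) V = c"
        proof
          fix c assume c: "c \<in> ?B"
          show "restrict (restrict c ?V \<circ> r) V = c"
          proof
            fix z
            have "c z = undefined" if "z \<notin> V" using c that by (blast dest: PiE_arb)
            then show "restrict (restrict c ?V \<circ> r) V z = c z"
              using c xy False by (simp add: r_def)
          qed
        qed
        show "\<forall>c\<in>?C ?V M k. restrict (restrict (c \<circ> r) V) ?V = c"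
        proof
          fix c assume c: "c \<in> ?C ?V M k"
          show "restrict (restrict (c \<circ> r) V) ?V = c"
          proof
            fix z
            have "c z = undefined" if "z \<notin> ?V" using c that by (blast dest: PiE_arb)
            then show "restrict (restrict (c \<circ> r) V) ?V z = c z"
              by (auto simp: r_def)
          qed
        qed
        show "(\<lambda>c. restrict c ?V) ` ?B \<subseteq> ?C ?V M k"
        proof
          fix d assume "d \<in> (\<lambda>c. restrict c ?V) ` ?B"
          then obtain c where c: "c \<in> ?B" "d = restrict c ?V" by blast
          have "c (r z) = c z" for z using c(1) by (simp add: r_def)
          moreover have "r z \<in> ?V" if "z \<in> V" for z using that xy False by (simp add: r_def)
          ultimately have d: "d (r z) = c z" if "z \<in> V" for z
            using that c(2) by (metis restrict_apply')
          have "d (r a) \<noteq> d (r b)" if "(a, b) \<in> set L'" for a b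
          proof -
            have "a \<in> V" "b \<in> V" "c a \<noteq> c b" using that L' c(1) by blast+
            then show ?thesis by (simp add: d)
          qed
          then have "\<forall>(a, b) \<in> set M. d a \<noteq> d b" by (auto simp: M_def)
          moreover have "d \<in> ?V \<rightarrow>\<^sub>E {..<k}" unfolding c(2) using c(1) by (simp add: PiE_iff)
          ultimately show "d \<in> ?C ?V M k" by blast
        qed
        show "(\<lambda>c. restrict (c \<circ> r) V) ` ?C ?V M k \<subseteq> ?B"
        proof
          fix d assume "d \<in> (\<lambda>c. restrict (c \<circ> r) V) ` ?C ?V M k"
          then obtain c where c: "c \<in> ?C ?V M k" "d = restrict (c \<circ> r) V" by blast
          have "d a \<noteq> d b" if "(a, b) \<in> set L'" for a b
          proof -
            have "a \<in> V" "b \<in> V" using that L' by blast+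
            moreover have "(r a, r b) \<in> set M" using that by (force simp: M_def)
            then have "c (r a) \<noteq> c (r b)" using c(1) by blast
            ultimately show ?thesis by (simp add: c(2))
          qed
          moreover have "r z \<in> ?V" if "z \<in> V" for z using that xy False by (simp add: r_def)
          then have "d \<in> V \<rightarrow>\<^sub>E {..<k}" unfolding c(2) using c(1)
            by (simp add: PiE_iff)
          moreover have "d x = d y" using c(2) xy by (simp add: r_def)
          ultimately show "d \<in> ?B" by blast
        qed
      qed
      then have "card ?B = card (?C ?V M k)" by (rule bij_betw_same_card)
      moreover have "?C V L' k = ?C V L k \<union> ?B" "?C V L k \<inter> ?B = {}" using L by auto
      ultimately show ?thesis
        by (metis (no_types, lifting) card_Un_disjoint fin finite_Un)
    qed
    have "\<forall>k. poly (p - p') (int k) = int (card (?C V L k))"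
      using p p' by (simp flip: eq)
    then show ?thesis by blast
  qed
qed

lemma poly_chromatic_poly:
  assumes "finite V"
  shows "poly (chromatic_poly V E) (int k) = int (card (proper_colorings V E k))"
proof -
  have "finite {(x, y) \<in> V \<times> V. {x, y} \<in> E}"
    by (rule finite_subset[of _ "V \<times> V"]) (use assms in auto)
  then obtain L where L: "set L = {(x, y) \<in> V \<times> V. {x, y} \<in> E}"
    using finite_list by blast
  have "{c \<in> V \<rightarrow>\<^sub>E {..<k}. \<forall>(x, y) \<in> set L. c x \<noteq> c y} = proper_colorings V E k" for k
    unfolding proper_colorings_def L by blast
  moreover have "set L \<subseteq> V \<times> V" using L by auto
  ultimately obtain p :: "int poly"
    where p: "\<forall>k. poly p (int k) = int (card (proper_colorings V E k))"
    using ex_poly_card_constrained_colorings[OF assms, of L] by auto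
  have "p' = p" if "\<forall>k. poly p' (int k) = int (card (proper_colorings V E k))" for p'
  proof (rule ccontr)
    assume "p' \<noteq> p"
    then have "finite {x. poly (p' - p) x = 0}" by (intro poly_roots_finite) simp
    moreover have "range int \<subseteq> {x. poly (p' - p) x = 0}" using p that by auto
    ultimately have "finite (range int)" by (rule rev_finite_subset)
    then show False using range_inj_infinite inj_of_nat by blast
  qed
  with p have "\<forall>k. poly (chromatic_poly V E) (int k) = int (card (proper_colorings V E k))"
    unfolding chromatic_poly_def by (rule theI)
  then show ?thesis by blast
qed

text \<open>The edges of the inversion graph \<open>G\<^sub>w\<close>, whose vertex set is \<open>{1..n}\<close>.\<close>

definition inversion_edges :: "nat \<Rightarrow> (nat \<Rightarrow> nat) \<Rightarrow> nat set set" where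
  "inversion_edges n w = {{i, j} | i j. i \<in> {1..n} \<and> j \<in> {1..n} \<and> i < j \<and> w i > w j}"

definition inversion_chromatic_poly :: "nat \<Rightarrow> (nat \<Rightarrow> nat) \<Rightarrow> int poly" where
  "inversion_chromatic_poly n w = chromatic_poly {1..n} (inversion_edges n w)"

text \<open>The indeterminate \<open>q\<close> of the field of rational functions (fractions of integer
  polynomials), in which substituting \<open>- q\<inverse>\<close> into a polynomial makes sense.\<close>

definition indet :: "int poly fract" where
  "indet = Fract [:0, 1:] 1"


section \<open>Pattern avoidance\<close>

text \<open>A pattern in \<open>\<SS>\<^sub>m\<close> is given by its one-line notation, a list of length \<open>m\<close>; its positions
  are therefore numbered from \<open>0\<close>.\<close>

definition avoids :: "nat \<Rightarrow> (nat \<Rightarrow> nat) \<Rightarrow> nat list \<Rightarrow> bool" where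
  "avoids n w p \<longleftrightarrow>
     \<not> (\<exists>i :: nat \<Rightarrow> nat. strict_mono_on {..<length p} i \<and> i ` {..<length p} \<subseteq> {1..n} \<and>
          (\<forall>a<length p. \<forall>b<length p. w (i a) < w (i b) \<longleftrightarrow> p ! a < p ! b))"

end

theory Submission
  imports Defs
begin

text \<open>Write \<open>u = w \<circ> s\<close>. For \<open>i = n, \<dots>, 1\<close>, merge into the cycle of \<open>i\<close> other cycles of \<open>s\<close>
  that lie on positions \<open>> i\<close>, each at its largest value \<open>w p\<close> below \<open>w i\<close>, in decreasing order
  of these values. Every merge is a downward edge of the Bruhat graph and lowers the number of
  cycles by one, so the permutations obtained lie in \<open>[e, w]\<close> at absolute length equal to the
  number of merges. For a fixed colouring \<open>c\<close>, the signed sum over the \<open>s\<close> with \<open>c \<circ> s = c\<close>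
  telescopes to the indicator that \<open>c\<close> is proper on \<open>G\<^sub>w\<close>. Hence the right-hand side is the
  generating function of the absolute length over the permutations obtained by merging, and
  the identity holds iff these exhaust \<open>[e, w]\<close>.

  A forbidden pattern yields an element of \<open>[e, w]\<close> that violates, on one of its cycles, an
  inequality preserved by merging. Conversely, elements of \<open>[e, w]\<close> satisfy
  \<open>min w(j..n) \<le> u j \<le> max w(1..j)\<close>, and avoidance of the patterns is what is needed to undo
  merges without leaving the set of permutations satisfying these bounds.\<close>

section \<open>Coxeter length and edges of the Bruhat graph\<close>

definition inversions :: "nat \<Rightarrow> (nat \<Rightarrow> nat) \<Rightarrow> (nat \<times> nat) set" where
  "inversions n x = {(a, b). a \<in> {1..n} \<and> b \<in> {1..n} \<and> a < b \<and> x b < x a}"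

lemma finite_inversions [simp]: "finite (inversions n x)"
  by (rule finite_subset[of _ "{1..n} \<times> {1..n}"]) (auto simp: inversions_def)

text \<open>An inversion of \<open>x\<close> is carried along by the transposition when this keeps
  its two positions in order, and is left in place otherwise. This injection into the inversions of
  \<open>x \<circ> transpose i j\<close> misses the new inversion \<open>(i, j)\<close>.\<close>

lemma card_inversions_less:
  assumes ij: "i \<in> {1..n}" "j \<in> {1..n}" "i < j" and less: "x i < x j"
  shows "card (inversions n x) < card (inversions n (x \<circ> transpose i j))"
proof -
  let ?t = "transpose i j"
  define f where "f = (\<lambda>(a, b). if ?t a < ?t b then (?t a, ?t b) else (a, b))"
  have "inj_on f (inversions n x)"
  proof (rule inj_onI)
    fix p q assume "p \<in> inversions n x" "q \<in> inversions n x" "f p = f q"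
    moreover obtain a b c d where "p = (a, b)" "q = (c, d)" by fastforce
    ultimately show "p = q"
      by (auto simp: f_def inversions_def split: if_splits)
        (metis transpose_involutory nat_neq_iff)+
  qed
  moreover have "f ` inversions n x \<subseteq> inversions n (x \<circ> ?t) - {(i, j)}"
  proof
    fix r assume "r \<in> f ` inversions n x"
    then obtain a b where ab: "(a, b) \<in> inversions n x" "r = f (a, b)" by auto
    then show "r \<in> inversions n (x \<circ> ?t) - {(i, j)}"
      using ij less by (auto simp: f_def inversions_def transpose_def split: if_splits)
  qed
  ultimately have "card (inversions n x) \<le> card (inversions n (x \<circ> ?t) - {(i, j)})"
    by (simp add: card_inj_on_le)
  also have "\<dots> < card (inversions n (x \<circ> ?t))"
    using ij less by (intro card_Diff1_less finite_inversions) (auto simp: inversions_def)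
  finally show ?thesis .
qed

lemma card_inversions_adjacent:
  assumes "i \<in> {1..n}" "Suc i \<in> {1..n}"
  shows "card (inversions n (x \<circ> transpose i (Suc i))) \<le> Suc (card (inversions n x))"
proof -
  let ?t = "transpose i (Suc i)"
  have "inj_on (map_prod ?t ?t) (inversions n (x \<circ> ?t) - {(i, Suc i)})"
    by (rule inj_on_subset[OF prod.inj_map]) (auto intro: inj_on_inverseI[of _ ?t])
  moreover have "map_prod ?t ?t ` (inversions n (x \<circ> ?t) - {(i, Suc i)}) \<subseteq> inversions n x"
    using assms by (auto simp: inversions_def transpose_def)
  ultimately have "card (inversions n (x \<circ> ?t) - {(i, Suc i)}) \<le> card (inversions n x)"
    by (simp add: card_inj_on_le)
  moreover have "card (inversions n (x \<circ> ?t)) \<le> Suc (card (inversions n (x \<circ> ?t) - {(i, Suc i)}))"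
    using card.remove[of "inversions n (x \<circ> ?t)" "(i, Suc i)"]
    by (cases "(i, Suc i) \<in> inversions n (x \<circ> ?t)") auto
  ultimately show ?thesis by linarith
qed

lemma card_inversions_word:
  assumes "set ss \<subseteq> adjacent_transpositions n"
  shows "card (inversions n (foldr (\<cdot>) ss id)) \<le> length ss"
  using assms
proof (induction ss)
  case Nil
  have "inversions n id = {}" by (auto simp: inversions_def)
  then show ?case by (simp add: id_def)
next
  case (Cons s ss)
  then obtain i where "s = transpose i (Suc i)" "1 \<le> i" "Suc i \<le> n"
    by (auto simp: adjacent_transpositions_def)
  then have "card (inversions n (foldr (\<cdot>) (s # ss) id)) \<le> Suc (card (inversions n (foldr (\<cdot>) ss id)))"
    using card_inversions_adjacent[of i n "foldr (\<cdot>) ss id"]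
    by (simp only: foldr.simps o_apply perm_mult_def) simp
  also have "\<dots> \<le> length (s # ss)" using Cons.IH Cons.prems by (simp add: id_def)
  finally show ?case .
qed

lemma word_of_inversions:
  assumes "x permutes {1..n}"
  shows "\<exists>ss. length ss \<le> card (inversions n x) \<and> set ss \<subseteq> adjacent_transpositions n
    \<and> x = foldr (\<cdot>) ss id"
  using assms
proof (induction "card (inversions n x)" arbitrary: x rule: less_induct)
  case less
  show ?case
  proof (cases "\<exists>i. 1 \<le> i \<and> Suc i \<le> n \<and> x (Suc i) < x i")
    case True
    then obtain i where i: "1 \<le> i" "Suc i \<le> n" "x (Suc i) < x i" by blast
    let ?t = "transpose i (Suc i)"
    have perm: "x \<circ> ?t permutes {1..n}"
      using less.prems i by (intro permutes_compose permutes_swap_id) auto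
    have "card (inversions n (x \<circ> ?t)) < card (inversions n (x \<circ> ?t \<circ> ?t))"
      using i by (intro card_inversions_less) auto
    then have lt: "card (inversions n (x \<circ> ?t)) < card (inversions n x)"
      by (simp add: comp_assoc)
    obtain ss where ss: "length ss \<le> card (inversions n (x \<circ> ?t))"
      "set ss \<subseteq> adjacent_transpositions n" "x \<circ> ?t = foldr (\<cdot>) ss id"
      using less.hyps[OF lt perm] by blast
    have "x = foldr (\<cdot>) (?t # ss) id"
      by (simp add: perm_mult_def comp_assoc flip: ss(3))
    moreover have "?t \<in> adjacent_transpositions n"
      using i by (auto simp: adjacent_transpositions_def)
    ultimately show ?thesis
      using ss lt by (intro exI[of _ "?t # ss"]) auto
  next
    case False
    have le: "i \<le> x i" if "1 \<le> i" "i \<le> n" for i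
      using that
    proof (induction i rule: dec_induct)
      case base
      then show ?case using permutes_in_image[OF less.prems, of 1] by auto
    next
      case (step i)
      have "x i \<noteq> x (Suc i)" using permutes_inj[OF less.prems] by (metis injD n_not_Suc_n)
      with step False show ?case by force
    qed
    then have "x = id" by (intro permutes_natset_ge[OF less.prems]) auto
    then show ?thesis by (intro exI[of _ "[]"]) simp
  qed
qed

lemma cox_length_eq_card_inversions:
  assumes "x permutes {1..n}"
  shows "cox_length n x = card (inversions n x)"
proof -
  obtain ss where ss: "length ss \<le> card (inversions n x)" "set ss \<subseteq> adjacent_transpositions n"
    "x = foldr (\<cdot>) ss id"
    using word_of_inversions[OF assms] by blast
  have "length ss = card (inversions n x)"
    using ss card_inversions_word[OF ss(2)] by simp
  then show ?thesis
    unfolding cox_length_def using ss card_inversions_word by (intro Least_equality) auto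
qed

text \<open>Since \<open>t \<cdot> x\<close> is \<open>x \<circ> t\<close> and length counts
  inversions, an edge is the exchange of two entries in ascending order. Later arguments use edges
  only in this form.\<close>

lemma bruhat_graph_iff:
  "(x, y) \<in> bruhat_graph n \<longleftrightarrow> x permutes {1..n} \<and>
     (\<exists>i j. i \<in> {1..n} \<and> j \<in> {1..n} \<and> i < j \<and> y = x \<circ> transpose i j \<and> x i < x j)"
proof -
  have "cox_length n x < cox_length n (x \<circ> transpose i j) \<longleftrightarrow> x i < x j"
    if x: "x permutes {1..n}" and ij: "i \<in> {1..n}" "j \<in> {1..n}" "i < j" for i j
  proof -
    have x': "x \<circ> transpose i j permutes {1..n}"
      using x ij by (intro permutes_compose permutes_swap_id) auto
    have ne: "x i \<noteq> x j" using permutes_inj[OF x] ij by (metis injD less_irrefl)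
    have "card (inversions n (x \<circ> transpose i j)) < card (inversions n x)" if "x j < x i"
      using card_inversions_less[OF ij, of "x \<circ> transpose i j"] that
      by (simp add: comp_assoc)
    with card_inversions_less[OF ij, of x] ne show ?thesis
      unfolding cox_length_eq_card_inversions[OF x] cox_length_eq_card_inversions[OF x']
      by (cases "x i < x j") auto
  qed
  note cox = this
  show ?thesis
  proof
    assume "(x, y) \<in> bruhat_graph n"
    then obtain i j where "x permutes {1..n}" "1 \<le> i" "i < j" "j \<le> n" "y = x \<circ> transpose i j"
      "cox_length n x < cox_length n (x \<circ> transpose i j)"
      by (auto simp: bruhat_graph_def transpositions_def sym_group_def perm_mult_def)
    with cox[of i j] show "x permutes {1..n} \<and> (\<exists>i j. i \<in> {1..n} \<and> j \<in> {1..n} \<and> i < j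
        \<and> y = x \<circ> transpose i j \<and> x i < x j)"
      by (intro conjI exI[of _ i] exI[of _ j]) auto
  next
    assume "x permutes {1..n} \<and> (\<exists>i j. i \<in> {1..n} \<and> j \<in> {1..n} \<and> i < j
        \<and> y = x \<circ> transpose i j \<and> x i < x j)"
    then obtain i j where *: "x permutes {1..n}" "i \<in> {1..n}" "j \<in> {1..n}" "i < j"
      "y = x \<circ> transpose i j" "x i < x j" by blast
    then have "cox_length n x < cox_length n (x \<circ> transpose i j)" using cox by simp
    moreover have "transpose i j \<in> transpositions n"
      using * by (auto simp: transpositions_def)
    ultimately show "(x, y) \<in> bruhat_graph n"
      using * by (auto simp: bruhat_graph_def sym_group_def perm_mult_def)
  qed
qed

lemma bruhat_graph_permutes:
  assumes "(x, y) \<in> bruhat_graph n"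
  shows "x permutes {1..n}" "y permutes {1..n}"
  using assms by (auto simp: bruhat_graph_iff intro!: permutes_compose permutes_swap_id)

lemma bruhat_graph_swap:
  assumes "x permutes {1..n}" "i \<in> {1..n}" "j \<in> {1..n}" "i < j" "x j < x i"
  shows "(x \<circ> transpose i j, x) \<in> bruhat_graph n"
  unfolding bruhat_graph_iff
proof (intro conjI exI)
  show "x \<circ> transpose i j permutes {1..n}"
    using assms by (intro permutes_compose permutes_swap_id) auto
qed (use assms in \<open>auto simp: comp_assoc\<close>)

section \<open>Merging cycles\<close>

text \<open>For a permutation \<open>s\<close> there are \<open>k\<close> to the number of cycles of
  \<open>s\<close> such colourings; this count stands in for the number of cycles
  throughout.\<close>

definition invariant_colorings :: "nat \<Rightarrow> nat \<Rightarrow> (nat \<Rightarrow> nat) \<Rightarrow> (nat \<Rightarrow> nat) set" where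
  "invariant_colorings n k s = {c \<in> {1..n} \<rightarrow>\<^sub>E {..<k}. \<forall>x\<in>{1..n}. c (s x) = c x}"

lemma finite_invariant_colorings [simp]: "finite (invariant_colorings n k s)"
  by (rule finite_subset[of _ "{1..n} \<rightarrow>\<^sub>E {..<k}"])
    (auto simp: invariant_colorings_def intro: finite_PiE)

lemma inj_stable_image_eq:
  assumes "inj s" "finite K" "s ` K \<subseteq> K"
  shows "s ` K = K"
  using assms by (meson endo_inj_surj inj_on_subset subset_UNIV)

text \<open>\<open>K\<close> is any union of cycles of \<open>s\<close> that contains
  \<open>p\<close> and not \<open>i\<close>, which lets the argument work with stable sets in place
  of cycles. Composing with \<open>transpose (s i) p\<close> joins the cycles of \<open>i\<close>
  and \<open>p\<close>.\<close>

locale cycle_merge =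
  fixes n :: nat and s :: "nat \<Rightarrow> nat" and i p :: nat and K :: "nat set"
  assumes s: "s permutes {1..n}" and i: "i \<in> {1..n}" "i \<notin> K"
    and K: "K \<subseteq> {1..n}" "p \<in> K" "s ` K \<subseteq> K"
begin

abbreviation merged :: "nat \<Rightarrow> nat" where
  "merged \<equiv> transpose (s i) p \<circ> s"

lemma K_image: "s ` K = K"
  by (rule inj_stable_image_eq) (use permutes_inj[OF s] K finite_subset in auto)

lemma in_K_iff: "s x \<in> K \<longleftrightarrow> x \<in> K"
proof -
  have "inj s" by (rule permutes_inj[OF s])
  then have "s x \<in> s ` K \<longleftrightarrow> x \<in> K" by (rule inj_image_mem_iff)
  then show ?thesis by (simp add: K_image)
qed

lemma si_neq: "s i \<noteq> p" "s i \<in> {1..n}" "s i \<notin> K"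
proof -
  show "s i \<notin> K" using in_K_iff i by simp
  then show "s i \<noteq> p" using K by auto
  show "s i \<in> {1..n}" using permutes_in_image[OF s] i by simp
qed

lemma ex_pre:
  "\<exists>e\<in>K. s e = p \<and> merged e = s i \<and> (\<forall>x. x \<noteq> e \<longrightarrow> x \<noteq> i \<longrightarrow> merged x = s x)"
proof -
  obtain e where e: "e \<in> K" "s e = p" using K_image K(2) by (metis imageE)
  have "merged x = s x" if "x \<noteq> e" "x \<noteq> i" for x
  proof -
    have "s x \<noteq> p" "s x \<noteq> s i" using that e permutes_inj[OF s] by (metis injD)+
    then show ?thesis by (simp add: transpose_def)
  qed
  then show ?thesis using e by (intro bexI[of _ e]) (auto simp: transpose_def)
qed

lemma merged_i: "merged i = p"
  by (simp add: transpose_def)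

lemma merged_permutes: "merged permutes {1..n}"
  using s si_neq K by (intro permutes_compose permutes_swap_id) auto

text \<open>The cycle of \<open>merged\<close> through \<open>p\<close> runs through the whole \<open>s\<close>-cycle of \<open>p\<close> and then
  continues at \<open>s i\<close>.\<close>

lemma closed_reaches:
  assumes C: "merged ` C \<subseteq> C" "p \<in> C"
  shows "s i \<in> C"
proof -
  obtain e where e: "e \<in> K" "s e = p" "merged e = s i"
    "\<And>x. x \<noteq> e \<Longrightarrow> x \<noteq> i \<Longrightarrow> merged x = s x" using ex_pre by blast
  \<comment> \<open>If the preimage \<open>e\<close> of \<open>p\<close> lay outside
    \<open>C\<close>, then \<open>merged\<close> and \<open>s\<close> would agree on
    \<open>C \<inter> K\<close> and make it stable under \<open>s\<close>, so the preimage of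
    \<open>p\<close> would lie in it after all.\<close>
  have "e \<in> C"
  proof (rule ccontr)
    assume ne: "e \<notin> C"
    have "s x \<in> C \<inter> K" if "x \<in> C \<inter> K" for x
    proof -
      have "merged x = s x" using that ne i by (intro e(4)) auto
      then show ?thesis using that C(1) K(3) by force
    qed
    then have "s ` (C \<inter> K) = C \<inter> K"
      using permutes_inj[OF s] finite_subset[OF K(1)] by (intro inj_stable_image_eq) auto
    then obtain x where "x \<in> C" "s x = p" using C(2) K(2) by (metis IntE IntI imageE)
    then show False using e ne permutes_inj[OF s] by (metis injD)
  qed
  then show ?thesis using C(1) e(3) by (metis image_subset_iff)
qed

text \<open>By \<open>closed_reaches\<close> for \<open>C\<close> and for its complement,
  \<open>p\<close> and \<open>s i\<close> lie both inside or both outside \<open>C\<close>, so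
  \<open>transpose (s i) p\<close> preserves \<open>C\<close>. Thus the cycles of \<open>s\<close>
  refine those of \<open>merged\<close>.\<close>

lemma closed_unmerge:
  assumes C: "C \<subseteq> {1..n}" "merged ` C \<subseteq> C"
  shows "s ` C \<subseteq> C"
proof -
  have C_image: "merged ` C = C"
    by (rule inj_stable_image_eq) (use permutes_inj[OF merged_permutes] C finite_subset[OF C(1)] in simp_all)
  then have iff: "merged x \<in> C \<longleftrightarrow> x \<in> C" for x
    using permutes_inj[OF merged_permutes] by (metis inj_image_mem_iff)
  then have "p \<in> C \<longleftrightarrow> i \<in> C" using merged_i by metis
  moreover have "s i \<in> C \<longleftrightarrow> p \<in> C"
    using closed_reaches[of C] closed_reaches[of "- C"] C iff by auto
  ultimately have "transpose (s i) p y \<in> C \<longleftrightarrow> y \<in> C" for y by (simp add: transpose_def)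
  then have "s x \<in> C \<longleftrightarrow> merged x \<in> C" for x by simp
  then show ?thesis using iff by auto
qed

lemma merged_invariant_iff:
  "(\<forall>x\<in>{1..n}. c (merged x) = c x) \<longleftrightarrow> (\<forall>x\<in>{1..n}. c (s x) = c x) \<and> c p = c i"
proof
  assume L: "\<forall>x\<in>{1..n}. c (merged x) = c x"
  have p: "c p = c i" using L i merged_i by metis
  have "merged ` {x \<in> {1..n}. c x = c i} \<subseteq> {x \<in> {1..n}. c x = c i}"
    using L permutes_in_image[OF merged_permutes] by auto
  then have "c (s i) = c i" using closed_reaches[of "{x \<in> {1..n}. c x = c i}"] p K by auto
  then have "c (transpose (s i) p y) = c y" for y using p by (simp add: transpose_def)
  then show "(\<forall>x\<in>{1..n}. c (s x) = c x) \<and> c p = c i" using L p by simp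
next
  assume R: "(\<forall>x\<in>{1..n}. c (s x) = c x) \<and> c p = c i"
  then have "c (transpose (s i) p y) = c y" for y using i by (simp add: transpose_def)
  then show "\<forall>x\<in>{1..n}. c (merged x) = c x" using R by simp
qed

text \<open>Exchanging the colours of \<open>p\<close> and \<open>i\<close> throughout
  \<open>K\<close> makes \<open>p\<close> and \<open>i\<close> agree, and the old colour of
  \<open>p\<close> suffices to reverse this. The factor \<open>k\<close> expresses that merging
  loses exactly one cycle.\<close>

lemma card_invariant_colorings_merged:
  "card (invariant_colorings n k s) = k * card (invariant_colorings n k merged)"
proof -
  define sw :: "nat \<Rightarrow> nat \<Rightarrow> (nat \<Rightarrow> nat) \<Rightarrow> nat \<Rightarrow> nat"
    where "sw = (\<lambda>a b c x. if x \<in> K then transpose a b (c x) else c x)"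
  have sw_inv: "sw a b c \<in> invariant_colorings n k s"
    if "c \<in> invariant_colorings n k s" "a < k" "b < k" for a b c
  proof -
    have "sw a b c \<in> {1..n} \<rightarrow>\<^sub>E {..<k}"
      using that K(1) by (auto simp: sw_def invariant_colorings_def transpose_def PiE_iff extensional_def)
    then show ?thesis
      using that by (auto simp: invariant_colorings_def sw_def in_K_iff)
  qed
  have merged: "invariant_colorings n k merged = {c \<in> invariant_colorings n k s. c p = c i}"
    unfolding invariant_colorings_def merged_invariant_iff by blast
  have lt: "c i < k" "c p < k" if "c \<in> invariant_colorings n k s" for c
    using that i K by (auto simp: invariant_colorings_def PiE_iff)
  let ?f = "\<lambda>c. (c p, sw (c p) (c i) c)" and ?g = "\<lambda>(b, c). sw b (c i) c"
  have "bij_betw ?f (invariant_colorings n k s) ({..<k} \<times> invariant_colorings n k merged)"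
  proof (rule bij_betw_byWitness[where f' = ?g])
    show "\<forall>c\<in>invariant_colorings n k s. ?g (?f c) = c"
      using i by (auto simp: sw_def fun_eq_iff)
    show "\<forall>d\<in>{..<k} \<times> invariant_colorings n k merged. ?f (?g d) = d"
      using i K by (auto simp: merged sw_def fun_eq_iff)
    show "?f ` invariant_colorings n k s \<subseteq> {..<k} \<times> invariant_colorings n k merged"
      using lt sw_inv i K by (auto simp: merged) (auto simp: sw_def)
    show "?g ` ({..<k} \<times> invariant_colorings n k merged) \<subseteq> invariant_colorings n k s"
      using lt sw_inv by (auto simp: merged)
  qed
  then have "card (invariant_colorings n k s) = card ({..<k} \<times> invariant_colorings n k merged)"
    by (rule bij_betw_same_card)
  then show ?thesis by (simp add: card_cartesian_product)
qed

end

section \<open>A lower bound for the absolute length\<close>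

text \<open>Over the field with two elements, each linear equation at most halves the number of
  solutions.\<close>

lemma card_colorings_equations:
  assumes "set ps \<subseteq> {1..n} \<times> {1..n}"
  shows "2 ^ n \<le> card {c \<in> {1..n} \<rightarrow>\<^sub>E {..<2::nat}. \<forall>(a, b)\<in>set ps. c a = c b} * 2 ^ length ps"
  using assms
proof (induction ps)
  case Nil
  then show ?case by (simp add: card_funcsetE)
next
  case (Cons q ps)
  obtain a b where q: "q = (a, b)" by fastforce
  let ?A = "{c \<in> {1..n} \<rightarrow>\<^sub>E {..<2::nat}. \<forall>(a, b)\<in>set ps. c a = c b}"
  let ?E = "{c \<in> ?A. c a = c b}" and ?N = "{c \<in> ?A. c a \<noteq> c b}"
  have fin: "finite ?A"
    by (rule finite_subset[of _ "{1..n} \<rightarrow>\<^sub>E {..<2}"]) (auto intro: finite_PiE)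
  have finE: "finite ?E" "finite ?N" by (rule finite_subset[OF _ fin], blast)+
  have "card ?N \<le> card ?E"
  proof (cases "?N = {}")
    case False
    then obtain d where d: "d \<in> ?N" by blast
    have ab: "a \<in> {1..n}" "b \<in> {1..n}" using Cons.prems q by auto
    \<comment> \<open>Adding a fixed colouring \<open>d\<close> that violates the new equation
      carries violating colourings injectively to satisfying ones.\<close>
    define f where "f = (\<lambda>c. \<lambda>x\<in>{1..n}. (c x + d x) mod 2)"
    have lt: "c x < 2" if "c \<in> ?A" "x \<in> {1..n}" for c x
      using that by (auto simp: PiE_iff)
    have "inj_on f ?N"
    proof (rule inj_onI)
      fix c c' assume c: "c \<in> ?N" "c' \<in> ?N" and eq: "f c = f c'"
      show "c = c'"
      proof (rule PiE_ext)
        show "c \<in> {1..n} \<rightarrow>\<^sub>E {..<2}" "c' \<in> {1..n} \<rightarrow>\<^sub>E {..<2}" using c by auto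
        fix x assume x: "x \<in> {1..n}"
        then have "(c x + d x) mod 2 = (c' x + d x) mod 2"
          using fun_cong[OF eq, of x] by (simp add: f_def)
        moreover have "c x < 2" "c' x < 2" "d x < 2" using lt x c d by auto
        ultimately show "c x = c' x" by presburger
      qed
    qed
    moreover have "f ` ?N \<subseteq> ?E"
    proof
      fix e assume "e \<in> f ` ?N"
      then obtain c where c: "c \<in> ?N" "e = f c" by blast
      have "c a < 2" "c b < 2" "d a < 2" "d b < 2" "c a \<noteq> c b" "d a \<noteq> d b"
        using lt ab c d by auto
      then have "(c a + d a) mod 2 = (c b + d b) mod 2" by presburger
      moreover have "x \<in> {1..n}" "y \<in> {1..n}" "c x = c y" "d x = d y" if "(x, y) \<in> set ps" for x y
        using that c d Cons.prems by auto
      ultimately show "e \<in> ?E" using c(2) ab by (auto simp: f_def)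
    qed
    ultimately show ?thesis using finE(1) by (rule card_inj_on_le)
  next
    case True
    then show ?thesis by (simp only: card.empty)
  qed
  moreover have "card (?E \<union> ?N) = card ?E + card ?N"
    using finE by (rule card_Un_disjoint) blast
  moreover have "?E \<union> ?N = ?A" by blast
  ultimately have AE: "card ?A \<le> 2 * card ?E" by simp
  have double: "a * 2 ^ length ps \<le> e * 2 ^ length (q # ps)" if "a \<le> 2 * e" for a e :: nat
    using that by simp
  have eq: "{c \<in> {1..n} \<rightarrow>\<^sub>E {..<2::nat}. \<forall>(a, b)\<in>set (q # ps). c a = c b} = ?E"
    using q by auto
  have "2 ^ n \<le> card ?A * 2 ^ length ps" using Cons by simp
  then show ?case unfolding eq using double[OF AE] by (rule le_trans)
qed

text \<open>Along the path, \<open>inv w \<circ> u\<close> is a product of \<open>m\<close>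
  transpositions, and a colouring that agrees on the two points of each of them is invariant under
  the product.\<close>

lemma path_swaps:
  assumes "(u, w) \<in> bruhat_graph n ^^ m" "w permutes {1..n}"
  shows "\<exists>ps. length ps = m \<and> set ps \<subseteq> {1..n} \<times> {1..n} \<and>
    (\<forall>c::nat \<Rightarrow> nat. (\<forall>(a, b)\<in>set ps. c a = c b) \<longrightarrow> (\<forall>x. c (inv w (u x)) = c x))"
  using assms(1)
proof (induction m arbitrary: u)
  case 0
  then show ?case using permutes_inverses[OF assms(2)] by auto
next
  case (Suc m)
  then obtain v where v: "(u, v) \<in> bruhat_graph n" "(v, w) \<in> bruhat_graph n ^^ m"
    by (meson relpow_Suc_D2)
  obtain ps where ps: "length ps = m" "set ps \<subseteq> {1..n} \<times> {1..n}"
    "\<And>c::nat \<Rightarrow> nat. \<forall>(a, b)\<in>set ps. c a = c b \<Longrightarrow> \<forall>x. c (inv w (v x)) = c x"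
    using Suc.IH[OF v(2)] by blast
  obtain i j where ij: "i \<in> {1..n}" "j \<in> {1..n}" "v = u \<circ> transpose i j"
    using v(1) unfolding bruhat_graph_iff by blast
  then have u: "u = v \<circ> transpose i j" by (simp add: comp_assoc)
  have "c (inv w (u x)) = c x" if c: "\<forall>(a, b)\<in>set ((i, j) # ps). c a = c b" for c :: "nat \<Rightarrow> nat" and x
  proof -
    have "c (inv w (u x)) = c (transpose i j x)" using c ps(3) by (simp add: u)
    also have "\<dots> = c x" using c by (simp add: transpose_def)
    finally show ?thesis .
  qed
  then show ?case using ps ij by (intro exI[of _ "(i, j) # ps"]) auto
qed

text \<open>Two colours suffice to read off that \<open>m\<close> is at least \<open>n\<close> minus
  the number of cycles of \<open>inv w \<circ> u\<close>.\<close>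

lemma card_invariant_colorings_path:
  assumes "(u, w) \<in> bruhat_graph n ^^ m" "w permutes {1..n}"
  shows "2 ^ n \<le> card (invariant_colorings n 2 (inv w \<circ> u)) * 2 ^ m"
proof -
  obtain ps where ps: "length ps = m" "set ps \<subseteq> {1..n} \<times> {1..n}"
    "\<And>c::nat \<Rightarrow> nat. \<forall>(a, b)\<in>set ps. c a = c b \<Longrightarrow> \<forall>x. c (inv w (u x)) = c x"
    using path_swaps[OF assms] by blast
  let ?A = "{c \<in> {1..n} \<rightarrow>\<^sub>E {..<2::nat}. \<forall>(a, b)\<in>set ps. c a = c b}"
  have "?A \<subseteq> invariant_colorings n 2 (inv w \<circ> u)"
    using ps(3) by (force simp: invariant_colorings_def)
  then have "card ?A \<le> card (invariant_colorings n 2 (inv w \<circ> u))"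
    by (intro card_mono) simp_all
  then have "card ?A * 2 ^ m \<le> card (invariant_colorings n 2 (inv w \<circ> u)) * 2 ^ m" by simp
  then show ?thesis using card_colorings_equations[OF ps(2)] unfolding ps(1) by (rule le_trans[rotated])
qed

section \<open>Merge sequences\<close>

locale sym_perm =
  fixes n :: nat and w :: "nat \<Rightarrow> nat"
  assumes w: "w permutes {1..n}"
begin

lemma w_eq_iff [simp]: "w x = w y \<longleftrightarrow> x = y"
  using permutes_inj[OF w] by (auto dest: injD)

lemma w_inv_w [simp]: "inv w (w x) = x" "w (inv w x) = x"
  using permutes_inverses[OF w] by auto

text \<open>A permutation \<open>u\<close> is written as \<open>w \<circ> s\<close>. The smallest choice of \<open>K\<close> is the cycle of \<open>p\<close>,
  so the condition says that among the elements of this cycle whose value is at most \<open>w i\<close>,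
  the value of \<open>p\<close> is the largest.\<close>

definition separable :: "nat \<Rightarrow> (nat \<Rightarrow> nat) \<Rightarrow> nat \<Rightarrow> bool" where
  "separable i s p \<longleftrightarrow>
     (\<exists>K\<subseteq>{1..n}. p \<in> K \<and> s ` K \<subseteq> K \<and> (\<forall>x\<in>K. \<not> (w p < w x \<and> w x \<le> w i)))"

text \<open>Descending to \<open>i\<close> leaves \<open>i\<close> fixed and a merge sends
  \<open>i\<close> to \<open>p\<close>. So the condition \<open>w p < w (s i)\<close> bounds the
  first value used at \<open>i\<close> by \<open>w i\<close> and makes the values used there
  decrease.\<close>

inductive merge_seq :: "nat \<Rightarrow> (nat \<Rightarrow> nat) \<Rightarrow> bool" where
  start: "merge_seq (Suc n) id"
| descend: "merge_seq (Suc i) s \<Longrightarrow> 1 \<le> i \<Longrightarrow> merge_seq i s"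
| merge: "merge_seq i s \<Longrightarrow> i < p \<Longrightarrow> p \<le> n \<Longrightarrow> w p < w (s i) \<Longrightarrow> separable i s p
    \<Longrightarrow> merge_seq i (transpose (s i) p \<circ> s)"

lemma merge_seq_basic:
  assumes "merge_seq i s"
  shows "1 \<le> i \<and> i \<le> Suc n \<and> s permutes {i..n} \<and> w (s i) \<le> w i"
  using assms
proof induction
  case start
  then show ?case by (simp add: id_def)
next
  case (descend i s)
  then have s: "s permutes {Suc i..n}" "i \<le> n" "1 \<le> i" by auto
  then have "s permutes {i..n}" by (auto intro: permutes_subset)
  moreover have "s i = i" using s(1) by (rule permutes_not_in) simp
  ultimately show ?case using s by simp
next
  case (merge i s p)
  then have s: "s permutes {i..n}" and ip: "i \<in> {i..n}" "p \<in> {i..n}" by auto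
  then have "s i \<in> {i..n}" using permutes_in_image[OF s] by blast
  then have "transpose (s i) p \<circ> s permutes {i..n}"
    using s ip by (intro permutes_compose permutes_swap_id)
  then show ?case using merge by (simp add: comp_def)
qed

lemma merge_seq_permutes:
  assumes "merge_seq i s"
  shows "s permutes {1..n}"
proof -
  have "s permutes {i..n}" "{i..n} \<subseteq> {1..n}" using merge_seq_basic[OF assms] by auto
  then show ?thesis by (rule permutes_subset)
qed

lemma separable_cycle_merge:
  assumes "merge_seq i s" "i < p" "p \<le> n" "w p < w (s i)" "separable i s p"
  shows "\<exists>K. cycle_merge n s i p K \<and> (\<forall>x\<in>K. \<not> (w p < w x \<and> w x \<le> w i))"
proof -
  obtain K where K: "K \<subseteq> {1..n}" "p \<in> K" "s ` K \<subseteq> K"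
    and free: "\<forall>x\<in>K. \<not> (w p < w x \<and> w x \<le> w i)"
    using assms(5) unfolding separable_def by blast
  note basic = merge_seq_basic[OF assms(1)]
  have "w p < w i" using assms(4) basic by auto
  \<comment> \<open>The value \<open>w i\<close> itself lies in the range above \<open>w p\<close>
    that \<open>K\<close> avoids.\<close>
  then have "i \<notin> K" using free by auto
  then have "cycle_merge n s i p K"
    using merge_seq_permutes[OF assms(1)] K basic assms by unfold_locales auto
  then show ?thesis using free by blast
qed

text \<open>If \<open>s\<close> sends \<open>e\<close> to \<open>p\<close>, the merge exchanges the
  entries of \<open>w \<circ> s\<close> at \<open>i\<close> and \<open>e\<close>. Since
  \<open>i < e\<close> and \<open>w p < w (s i)\<close>, this is a step down.\<close>

lemma merge_edge:
  assumes "merge_seq i s" "i < p" "p \<le> n" "w p < w (s i)" "separable i s p"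
  shows "(w \<circ> (transpose (s i) p \<circ> s), w \<circ> s) \<in> bruhat_graph n"
proof -
  obtain K where cm: "cycle_merge n s i p K" using separable_cycle_merge[OF assms] by blast
  interpret cycle_merge n s i p K by (rule cm)
  obtain e where e: "e \<in> K" "s e = p" "merged e = s i"
    "\<And>x. x \<noteq> e \<Longrightarrow> x \<noteq> i \<Longrightarrow> merged x = s x" using ex_pre by blast
  note basic = merge_seq_basic[OF assms(1)]
  have "e \<in> {i..n}" using permutes_in_image[of s "{i..n}" e] basic e(2) assms by auto
  moreover have "e \<noteq> i" using e(1) i by auto
  ultimately have ie: "i < e" "e \<in> {1..n}" using i by auto
  have "w \<circ> s = (w \<circ> merged) \<circ> transpose i e"
  proof
    fix x show "(w \<circ> s) x = ((w \<circ> merged) \<circ> transpose i e) x"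
      by (cases "x = i"; cases "x = e") (use e merged_i in \<open>auto simp: transpose_def\<close>)
  qed
  moreover have "w \<circ> merged permutes {1..n}"
    using merged_permutes w by (rule permutes_compose)
  ultimately show ?thesis
    unfolding bruhat_graph_iff using ie i e(3) merged_i assms(4)
    by (intro conjI exI[of _ i] exI[of _ e]) auto
qed

lemma merge_seq_path:
  assumes "merge_seq i s"
  shows "\<exists>m\<le>n. (w \<circ> s, w) \<in> bruhat_graph n ^^ m \<and> (\<forall>k. card (invariant_colorings n k s) * k ^ m = k ^ n)"
proof -
  have "\<exists>m. (w \<circ> s, w) \<in> bruhat_graph n ^^ m \<and> (\<forall>k. card (invariant_colorings n k s) * k ^ m = k ^ n)"
    using assms
  proof induction
    case start
    show ?case by (intro exI[of _ 0]) (simp add: invariant_colorings_def card_funcsetE)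
  next
    case (descend i s)
    then show ?case by blast
  next
    case (merge i s p)
    then obtain m where m: "(w \<circ> s, w) \<in> bruhat_graph n ^^ m"
      "\<And>k. card (invariant_colorings n k s) * k ^ m = k ^ n" by blast
    obtain K where cm: "cycle_merge n s i p K" using separable_cycle_merge[OF merge.hyps] by blast
    interpret cycle_merge n s i p K by (rule cm)
    have "card (invariant_colorings n k merged) * k ^ Suc m = k ^ n" for k
      using m(2)[of k] card_invariant_colorings_merged[of k] by (simp add: mult_ac)
    then show ?case using relpow_Suc_I2[OF merge_edge[OF merge.hyps] m(1)] by blast
  qed
  then obtain m where m: "(w \<circ> s, w) \<in> bruhat_graph n ^^ m"
    "\<And>k. card (invariant_colorings n k s) * k ^ m = k ^ n" by blast
  have "(2::nat) ^ m \<le> 2 ^ n" using m(2)[of 2] by (metis dvd_imp_le dvd_triv_right zero_less_numeral zero_less_power)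
  then have "m \<le> n" by simp
  with m show ?thesis by blast
qed

section \<open>Absolute length of merged permutations\<close>

definition al :: "(nat \<Rightarrow> nat) \<Rightarrow> nat" where
  "al s = abs_length n (w \<circ> s) w"

lemma abs_length_path:
  assumes "(u, w) \<in> bruhat_graph n ^^ m"
  shows "(u, w) \<in> bruhat_graph n ^^ abs_length n u w"
  unfolding abs_length_def using assms by (rule LeastI)

text \<open>A path whose length is \<open>n\<close> minus the number of cycles attains the lower
  bound obtained from two-colourings, so it is shortest.\<close>

lemma al_unique:
  assumes "(w \<circ> s, w) \<in> bruhat_graph n ^^ m" "card (invariant_colorings n 2 s) * 2 ^ m = 2 ^ n"
  shows "al s = m"
proof -
  have "inv w \<circ> (w \<circ> s) = s" by (simp add: fun_eq_iff)
  then have "card (invariant_colorings n 2 s) * 2 ^ m \<le> card (invariant_colorings n 2 s) * 2 ^ al s"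
    using card_invariant_colorings_path[OF abs_length_path[OF assms(1)] w] assms(2) by (simp add: al_def)
  moreover have "card (invariant_colorings n 2 s) > 0" using assms(2) by (intro gr0I) simp
  ultimately have "(2::nat) ^ m \<le> 2 ^ al s" by simp
  then have "m \<le> al s" by simp
  moreover have "al s \<le> m" unfolding al_def abs_length_def using assms(1) by (rule Least_le)
  ultimately show ?thesis by simp
qed

lemma merge_seq_al:
  assumes "merge_seq i s"
  shows "al s \<le> n" "card (invariant_colorings n k s) * k ^ al s = k ^ n"
    "(w \<circ> s, w) \<in> bruhat_graph n ^^ al s"
  using merge_seq_path[OF assms] al_unique by blast+

lemma al_id [simp]: "al id = 0"
  using al_unique[of id 0] by (simp add: invariant_colorings_def card_funcsetE)

lemma al_merge:
  assumes "merge_seq i s" "i < p" "p \<le> n" "w p < w (s i)" "separable i s p"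
  shows "al (transpose (s i) p \<circ> s) = Suc (al s)"
proof (rule al_unique)
  show "(w \<circ> (transpose (s i) p \<circ> s), w) \<in> bruhat_graph n ^^ Suc (al s)"
    using merge_edge[OF assms] merge_seq_al(3)[OF assms(1)] by (rule relpow_Suc_I2)
  obtain K where cm: "cycle_merge n s i p K" using separable_cycle_merge[OF assms] by blast
  interpret cycle_merge n s i p K by (rule cm)
  show "card (invariant_colorings n 2 merged) * 2 ^ Suc (al s) = 2 ^ n"
    using merge_seq_al(2)[OF assms(1), of 2] card_invariant_colorings_merged[of 2] by simp
qed


section \<open>Reversing merges\<close>

text \<open>A stable set witnessing that \<open>q\<close> is separable contains neither
  \<open>p\<close> nor \<open>i\<close>, whose values lie in the range excluded for
  \<open>q\<close>, so the merge at \<open>p\<close> does not affect it. Conversely, a set stable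
  after the merge was stable before.\<close>

lemma separable_merge_iff:
  assumes "merge_seq i s" "i < p" "p \<le> n" "w p < w (s i)" "separable i s p" and q: "w q < w p"
  shows "separable i (transpose (s i) p \<circ> s) q \<longleftrightarrow> separable i s q"
proof -
  obtain K where cm: "cycle_merge n s i p K" using separable_cycle_merge[OF assms(1-5)] by blast
  interpret cycle_merge n s i p K by (rule cm)
  have wp: "w p < w i" using merge_seq_basic[OF assms(1)] assms(4) by auto
  have notin: "i \<notin> C" "p \<notin> C" if "\<forall>x\<in>C. \<not> (w q < w x \<and> w x \<le> w i)" for C
    using that wp q by auto
  show ?thesis
  proof
    assume "separable i merged q"
    then show "separable i s q" unfolding separable_def using closed_unmerge by blast
  next
    assume "separable i s q"
    then obtain C where C: "C \<subseteq> {1..n}" "q \<in> C" "s ` C \<subseteq> C"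
      "\<forall>x\<in>C. \<not> (w q < w x \<and> w x \<le> w i)" unfolding separable_def by blast
    note notin = notin[OF C(4)]
    have "merged x \<in> C" if x: "x \<in> C" for x
    proof -
      have "s x \<in> C" using x C(3) by blast
      moreover have "s x \<noteq> s i" using x notin permutes_inj[OF s] by (metis injD)
      moreover have "s x \<noteq> p" using calculation notin by metis
      ultimately show ?thesis by (simp add: transpose_def)
    qed
    then show "separable i merged q" unfolding separable_def using C by (intro exI[of _ C]) auto
  qed
qed

text \<open>On the merged cycle, starting from \<open>p\<close>, the first element with value above
  \<open>w p\<close> and at most \<open>w i\<close> is where the old cycle of \<open>i\<close>
  resumes. Hence the merge can be undone from its result.\<close>

lemma merge_inj:
  assumes s: "merge_seq i s" "i < p" "p \<le> n" "w p < w (s i)" "separable i s p"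
    and s': "merge_seq i s'" "i < p" "p \<le> n" "w p < w (s' i)" "separable i s' p"
    and eq: "transpose (s i) p \<circ> s = transpose (s' i) p \<circ> s'"
  shows "s = s'"
proof -
  obtain K where cm: "cycle_merge n s i p K" and K: "\<And>x. x \<in> K \<Longrightarrow> \<not> (w p < w x \<and> w x \<le> w i)"
    using separable_cycle_merge[OF s] by blast
  obtain K' where cm': "cycle_merge n s' i p K'" and K': "\<And>x. x \<in> K' \<Longrightarrow> \<not> (w p < w x \<and> w x \<le> w i)"
    using separable_cycle_merge[OF s'] by blast
  interpret A: cycle_merge n s i p K by (rule cm)
  interpret B: cycle_merge n s' i p K' by (rule cm')
  obtain e where e: "e \<in> K" "s e = p" "A.merged e = s i"
    "\<And>x. x \<noteq> e \<Longrightarrow> x \<noteq> i \<Longrightarrow> A.merged x = s x" using A.ex_pre by blast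
  obtain e' where e': "e' \<in> K'" "s' e' = p" "B.merged e' = s' i"
    "\<And>x. x \<noteq> e' \<Longrightarrow> x \<noteq> i \<Longrightarrow> B.merged x = s' x" using B.ex_pre by blast
  have window: "w (s i) \<le> w i" "w (s' i) \<le> w i"
    using merge_seq_basic s(1) s'(1) by auto
  show ?thesis
  proof (cases "e = e'")
    case True
    then have "s i = s' i" using e(3) e'(3) eq by simp
    then have "transpose (s i) p \<circ> (transpose (s i) p \<circ> s) = transpose (s i) p \<circ> (transpose (s i) p \<circ> s')"
      using eq by simp
    then show ?thesis by (simp add: comp_assoc[symmetric])
  next
    case False
    \<comment> \<open>If the preimages of \<open>p\<close> under \<open>s\<close> and
      \<open>s'\<close> differ, this intersection is stable under the common result. It contains
      \<open>p\<close> and therefore the preimage \<open>i\<close> of \<open>p\<close>, which is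
      impossible.\<close>
    define C where "C = K \<inter> K'"
    have "A.merged x \<in> C" if x: "x \<in> C" for x
    proof -
      have xK: "x \<in> K" "x \<in> K'" "x \<noteq> i" using x A.i(2) by (auto simp: C_def)
      have "x \<noteq> e"
      proof
        assume "x = e"
        then have "s i = s' x" using e(3) e'(4) eq False xK(3) by metis
        moreover have "s' x \<in> K'" using B.K(3) xK by blast
        ultimately show False using K'[of "s i"] s(4) window by simp
      qed
      moreover have "x \<noteq> e'"
      proof
        assume "x = e'"
        then have "s' i = s x" using e'(3) e(4) eq False xK(3) by metis
        moreover have "s x \<in> K" using A.K(3) xK by blast
        ultimately show False using K[of "s' i"] s'(4) window by simp
      qed
      ultimately have "A.merged x = s x" "A.merged x = s' x" using e(4) e'(4) eq xK(3) by metis+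
      moreover have "s x \<in> K" "s' x \<in> K'" using A.K(3) B.K(3) xK by blast+
      ultimately show ?thesis unfolding C_def by (metis IntI)
    qed
    then have "A.merged ` C = C"
      using permutes_inj[OF A.merged_permutes] finite_subset[OF A.K(1)]
      by (intro inj_stable_image_eq) (auto simp: C_def)
    then obtain x where "x \<in> C" "A.merged x = p"
      using A.K(2) B.K(2) by (metis C_def IntI imageE)
    then have "i \<in> C" using A.merged_i permutes_inj[OF A.merged_permutes] by (metis injD)
    then show ?thesis using A.i(2) by (simp add: C_def)
  qed
qed

lemma merge_seq_last:
  assumes "merge_seq i s" "i \<le> n" "s i \<noteq> i"
  shows "\<exists>s0. merge_seq i s0 \<and> i < s i \<and> s i \<le> n \<and> w (s i) < w (s0 i) \<and> separable i s0 (s i)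
    \<and> s = transpose (s0 i) (s i) \<circ> s0"
  using assms(1)
proof cases
  case start
  then show ?thesis using assms by simp
next
  case descend
  then have "s permutes {Suc i..n}" using merge_seq_basic by blast
  then have "s i = i" by (rule permutes_not_in) simp
  then show ?thesis using assms by simp
next
  case (merge s0 p)
  then have "s i = p" by simp
  then show ?thesis using merge by blast
qed

lemma merge_seq_fixed_iff:
  assumes "i \<in> {1..n}"
  shows "merge_seq i s \<and> s i = i \<longleftrightarrow> merge_seq (Suc i) s"
proof
  assume s: "merge_seq i s \<and> s i = i"
  from s have "merge_seq i s" by simp
  then show "merge_seq (Suc i) s"
  proof cases
    case (merge s0 p)
    then have "s i = p" by simp
    then show ?thesis using merge s by simp
  qed (use assms in auto)
next
  assume s: "merge_seq (Suc i) s"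
  then have "s permutes {Suc i..n}" using merge_seq_basic by blast
  then have "s i = i" by (rule permutes_not_in) simp
  then show "merge_seq i s \<and> s i = i" using s assms merge_seq.descend by auto
qed

lemma finite_merge_seq [simp]: "finite {s. merge_seq i s}"
  by (rule finite_subset[OF _ finite_permutations[of "{1..n}"]]) (use merge_seq_permutes in blast, simp)

lemma finite_merge_seq' [simp]: "finite {s. merge_seq i s \<and> P s}"
  by (rule finite_subset[OF _ finite_merge_seq]) blast

section \<open>Signed sums over colour-preserving permutations\<close>

text \<open>The position \<open>s i\<close> is that of the last merge at \<open>i\<close> and the
  values used decrease, so \<open>v\<close> bounds from below all values used at \<open>i\<close>.
  Lowering \<open>v\<close> from \<open>w i\<close> to \<open>0\<close> releases these merges one
  value at a time.\<close>

definition stage :: "nat \<Rightarrow> nat \<Rightarrow> (nat \<Rightarrow> nat) \<Rightarrow> (nat \<Rightarrow> nat) set" where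
  "stage i v c = {s. merge_seq i s \<and> v \<le> w (s i) \<and> (\<forall>x\<in>{1..n}. c (s x) = c x)}"

lemma finite_stage [simp]: "finite (stage i v c)"
  unfolding stage_def by simp

lemma stage_split:
  assumes p: "i < p" "p \<le> n"
  shows "stage i (w p) c = stage i (Suc (w p)) c \<union>
    (\<lambda>s. transpose (s i) p \<circ> s) ` {s \<in> stage i (Suc (w p)) c. separable i s p \<and> c p = c i}"
    (is "?L = ?A \<union> ?T ` ?D")
proof (rule set_eqI)
  have inv: "(\<forall>x\<in>{1..n}. c (?T s x) = c x) \<longleftrightarrow> (\<forall>x\<in>{1..n}. c (s x) = c x) \<and> c p = c i"
    if s: "merge_seq i s" "w p < w (s i)" "separable i s p" for s
  proof -
    obtain K where cm: "cycle_merge n s i p K" using separable_cycle_merge[OF s(1) p s(2,3)] by blast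
    interpret cycle_merge n s i p K by (rule cm)
    show ?thesis by (rule merged_invariant_iff)
  qed
  fix s
  show "s \<in> ?L \<longleftrightarrow> s \<in> ?A \<union> ?T ` ?D"
  proof
    assume s: "s \<in> ?L"
    show "s \<in> ?A \<union> ?T ` ?D"
    proof (cases "w (s i) = w p")
      case True
      then have si: "s i = p" by simp
      then obtain s0 where s0: "merge_seq i s0" "w p < w (s0 i)" "separable i s0 p" "s = ?T s0"
        using merge_seq_last[of i s] s p by (auto simp: stage_def)
      moreover have "s0 \<in> ?D" using inv[OF s0(1-3)] s s0 by (simp add: stage_def)
      ultimately show ?thesis by blast
    qed (use s in \<open>auto simp: stage_def simp del: w_eq_iff\<close>)
  next
    assume "s \<in> ?A \<union> ?T ` ?D"
    then show "s \<in> ?L"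
    proof
      assume "s \<in> ?T ` ?D"
      then obtain s0 where s0: "s0 \<in> ?D" "s = ?T s0" by blast
      then have s0': "merge_seq i s0" "w p < w (s0 i)" "separable i s0 p" by (auto simp: stage_def)
      have "\<forall>x\<in>{1..n}. c (s x) = c x" unfolding s0(2) inv[OF s0'] using s0 by (simp add: stage_def)
      moreover have "s i = p" using s0 by simp
      moreover have "merge_seq i s" unfolding s0(2) using s0' p by (intro merge_seq.merge)
      ultimately show ?thesis by (simp add: stage_def)
    qed (auto simp: stage_def)
  qed
qed

text \<open>On \<open>stage i v c\<close> this says that every merge still possible at a value below
  \<open>v\<close> would join two different colours.\<close>

definition unmerged :: "nat \<Rightarrow> nat \<Rightarrow> (nat \<Rightarrow> nat) \<Rightarrow> (nat \<Rightarrow> nat) \<Rightarrow> bool" where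
  "unmerged i v c s \<longleftrightarrow> (\<forall>p. i < p \<longrightarrow> p \<le> n \<longrightarrow> w p < v \<longrightarrow> separable i s p \<longrightarrow> c p \<noteq> c i)"

text \<open>Merging at the position \<open>p\<close> of value \<open>v\<close> changes the sign, so
  each element of \<open>D\<close>, where this merge is possible and respects the colours, cancels
  against its image. What remains is unmerged up to and including \<open>v\<close>.\<close>

lemma signed_sum_step:
  assumes "i \<in> {1..n}" "v < w i"
  shows "(\<Sum>s | s \<in> stage i v c \<and> unmerged i v c s. (- 1 :: int) ^ al s) =
    (\<Sum>s | s \<in> stage i (Suc v) c \<and> unmerged i (Suc v) c s. (- 1) ^ al s)"
proof (cases "i < inv w v \<and> inv w v \<le> n")
  case True
  define p where "p = inv w v"
  have p: "i < p" "p \<le> n" "w p = v" using True by (auto simp: p_def)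
  define T where "T = (\<lambda>s. transpose (s i) p \<circ> s)"
  define A where "A = {s \<in> stage i (Suc v) c. unmerged i v c s}"
  define D where "D = {s \<in> A. separable i s p \<and> c p = c i}"
  have D: "merge_seq i s" "w p < w (s i)" "separable i s p" if "s \<in> D" for s
    using that p by (auto simp: D_def A_def stage_def)
  have alT: "al (T s) = Suc (al s)" if "s \<in> D" for s
    unfolding T_def using D[OF that] p(1,2) by (intro al_merge)
  have unm: "unmerged i v c (T s) \<longleftrightarrow> unmerged i v c s"
    if "merge_seq i s" "w p < w (s i)" "separable i s p" for s
    using separable_merge_iff[OF that(1) p(1,2) that(2,3)] p(3) unfolding unmerged_def T_def by auto
  have "{s \<in> stage i v c. unmerged i v c s} = A \<union> T ` D"
  proof -
    have "{s \<in> T ` {s \<in> stage i (Suc v) c. separable i s p \<and> c p = c i}. unmerged i v c s} = T ` D"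
      using unm p by (auto simp: D_def A_def stage_def)
    then show ?thesis
      using stage_split[OF p(1,2), of c] unfolding p(3) A_def T_def by blast
  qed
  moreover have "A \<inter> T ` D = {}" using p by (auto simp: A_def T_def stage_def)
  moreover have fin: "finite A" "finite D" by (auto simp: A_def D_def)
  moreover have "inj_on T D"
  proof (rule inj_onI)
    fix s s' assume "s \<in> D" "s' \<in> D" "T s = T s'"
    then show "s = s'"
      using D[of s] D[of s'] p(1,2) by (intro merge_inj[of i s p s']) (simp_all add: T_def)
  qed
  ultimately have "(\<Sum>s | s \<in> stage i v c \<and> unmerged i v c s. (- 1 :: int) ^ al s) =
      (\<Sum>s\<in>A. (- 1) ^ al s) + (\<Sum>s\<in>D. (- 1) ^ al (T s))"
    by (simp add: sum.union_disjoint sum.reindex)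
  also have "(\<Sum>s\<in>D. (- 1 :: int) ^ al (T s)) = (\<Sum>s\<in>D. - ((- 1) ^ al s))"
    by (intro sum.cong) (simp_all add: alT)
  also have "(\<Sum>s\<in>A. (- 1 :: int) ^ al s) + (\<Sum>s\<in>D. - ((- 1) ^ al s)) = (\<Sum>s\<in>A - D. (- 1) ^ al s)"
    using fin by (simp add: sum_negf sum_diff D_def)
  also have "A - D = {s \<in> stage i (Suc v) c. unmerged i (Suc v) c s}"
  proof -
    have vp: "w q = v \<longleftrightarrow> q = p" for q using p(3) by (metis w_eq_iff)
    then have "unmerged i (Suc v) c s \<longleftrightarrow> unmerged i v c s \<and> \<not> (separable i s p \<and> c p = c i)" for s
      unfolding unmerged_def less_Suc_eq vp using p(1,2) by blast
    then show ?thesis by (auto simp: A_def D_def)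
  qed
  finally show ?thesis by simp
next
  case False
  \<comment> \<open>Here \<open>v\<close> is not the value of a position to the right of
    \<open>i\<close>, for instance \<open>v = 0\<close>, so no merge at \<open>i\<close> uses
    it.\<close>
  have "w (s i) \<noteq> v" if "s \<in> stage i v c" for s
  proof
    assume v: "w (s i) = v"
    then have "inv w (w (s i)) = inv w v" by (rule arg_cong)
    then have si: "s i = inv w v" by simp
    have "merge_seq i s" "s i \<noteq> i" using that v assms by (auto simp: stage_def)
    then have "i < s i \<and> s i \<le> n" using merge_seq_last[of i s] assms(1) by auto
    then show False using False si by simp
  qed
  then have "stage i v c \<subseteq> stage i (Suc v) c" 
    unfolding stage_def subset_iff mem_Collect_eq Suc_le_eq by (metis le_neq_implies_less)
  then have "stage i v c = stage i (Suc v) c" by (auto simp: stage_def)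
  moreover have "unmerged i v c s = unmerged i (Suc v) c s" for s
  proof -
    have "w p \<noteq> v" if "i < p" "p \<le> n" for p using that False by auto
    then show ?thesis unfolding unmerged_def less_Suc_eq by blast
  qed
  ultimately show ?thesis by simp
qed

text \<open>For a colouring \<open>c\<close> the choices to merge or not to merge a cycle of colour \<open>c i\<close> into the
  cycle of \<open>i\<close> cancel, so that only \<open>s\<close> without any such choice contribute.\<close>

lemma signed_sum_stage:
  assumes "i \<in> {1..n}"
  shows "(\<Sum>s | merge_seq i s \<and> (\<forall>x\<in>{1..n}. c (s x) = c x). (- 1 :: int) ^ al s) =
    (\<Sum>s | merge_seq (Suc i) s \<and> (\<forall>x\<in>{1..n}. c (s x) = c x) \<and> unmerged i (w i) c s. (- 1) ^ al s)"
proof -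
  \<comment> \<open>The threshold is raised from \<open>0\<close>, where \<open>unmerged\<close>
    holds vacuously, to \<open>w i\<close>, where \<open>stage\<close> leaves only those
    \<open>s\<close> that fix \<open>i\<close>.\<close>
  have "(\<Sum>s | s \<in> stage i v c \<and> unmerged i v c s. (- 1 :: int) ^ al s) =
      (\<Sum>s | s \<in> stage i (w i) c \<and> unmerged i (w i) c s. (- 1) ^ al s)" if "v \<le> w i" for v
    using that by (induction v rule: inc_induct) (simp_all add: signed_sum_step[OF assms])
  from this[of 0] show ?thesis
  proof -
    have "{s. s \<in> stage i 0 c \<and> unmerged i 0 c s} = {s. merge_seq i s \<and> (\<forall>x\<in>{1..n}. c (s x) = c x)}"
      by (auto simp: stage_def unmerged_def)
    moreover have "w i \<le> w (s i) \<longleftrightarrow> s i = i" if "merge_seq i s" for s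
      using merge_seq_basic[OF that] by (metis dual_order.antisym order_refl w_eq_iff)
    then have "{s. s \<in> stage i (w i) c \<and> unmerged i (w i) c s} =
        {s. merge_seq (Suc i) s \<and> (\<forall>x\<in>{1..n}. c (s x) = c x) \<and> unmerged i (w i) c s}"
      unfolding stage_def merge_seq_fixed_iff[OF assms, symmetric] by blast
    ultimately show ?thesis using \<open>0 \<le> w i \<Longrightarrow> _\<close> by simp
  qed
qed

text \<open>Among the positions to the right of \<open>i\<close> with smaller value and the same
  colour, the one of largest value is separable: all positions to the right of \<open>i\<close> of
  this colour form a stable set with no value in between.\<close>

lemma unmerged_iff:
  assumes "i \<in> {1..n}" "merge_seq (Suc i) s" "\<forall>x\<in>{1..n}. c (s x) = c x"
  shows "unmerged i (w i) c s \<longleftrightarrow> (\<forall>p. i < p \<longrightarrow> p \<le> n \<longrightarrow> w p < w i \<longrightarrow> c p \<noteq> c i)"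
proof
  assume L: "unmerged i (w i) c s"
  show "\<forall>p. i < p \<longrightarrow> p \<le> n \<longrightarrow> w p < w i \<longrightarrow> c p \<noteq> c i"
  proof (rule ccontr)
    define N where "N = {p. i < p \<and> p \<le> n \<and> w p < w i \<and> c p = c i}"
    assume "\<not> ?thesis"
    then have "N \<noteq> {}" by (auto simp: N_def)
    moreover have "finite N" by (simp add: N_def)
    ultimately have "Max (w ` N) \<in> w ` N" "\<And>q. q \<in> N \<Longrightarrow> w q \<le> Max (w ` N)" by auto
    then obtain p where p: "p \<in> N" "\<And>q. q \<in> N \<Longrightarrow> w q \<le> w p" by (metis imageE)
    let ?K = "{x. i < x \<and> x \<le> n \<and> c x = c i}"
    have s: "s permutes {Suc i..n}" using merge_seq_basic assms(2) by blast
    have "s ` ?K \<subseteq> ?K"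
    proof
      fix y assume "y \<in> s ` ?K"
      then obtain x where x: "y = s x" "i < x" "x \<le> n" "c x = c i" by blast
      then have "y \<in> {Suc i..n}" using permutes_in_image[OF s, of x] by auto
      moreover have "c y = c x" using assms x by auto
      ultimately show "y \<in> ?K" using x by auto
    qed
    moreover have "\<not> (w p < w x \<and> w x \<le> w i)" if "x \<in> ?K" for x
    proof
      assume x: "w p < w x \<and> w x \<le> w i"
      then have "w x < w i" using that by (metis (mono_tags, lifting) mem_Collect_eq nat_less_le w_eq_iff)
      then have "x \<in> N" using that by (simp add: N_def)
      then show False using p(2) x by fastforce
    qed
    ultimately have "separable i s p"
      unfolding separable_def using p(1) assms(1) by (intro exI[of _ ?K]) (auto simp: N_def)
    then show False using L p(1) by (auto simp: unmerged_def N_def)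
  qed
qed (auto simp: unmerged_def)

text \<open>Treating position \<open>i\<close> multiplies the sum by the indicator that no inversion
  \<open>(i, b)\<close> has both ends of one colour. At \<open>i = 1\<close> the indicator says that
  \<open>c\<close> is proper on the inversion graph.\<close>

lemma signed_sum_invariant:
  fixes c :: "nat \<Rightarrow> nat"
  assumes "1 \<le> i" "i \<le> Suc n"
  shows "(\<Sum>s | merge_seq i s \<and> (\<forall>x\<in>{1..n}. c (s x) = c x). (- 1 :: int) ^ al s) =
    of_bool (\<forall>a b. i \<le> a \<longrightarrow> a < b \<longrightarrow> b \<le> n \<longrightarrow> w b < w a \<longrightarrow> c b \<noteq> c a)"
  using assms(2,1)
proof (induction i rule: inc_induct)
  case base
  have "merge_seq (Suc n) s \<and> (\<forall>x\<in>{1..n}. c (s x) = c x) \<longleftrightarrow> s = id" for s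
    using merge_seq_basic[of "Suc n" s] merge_seq.start by auto
  then have "{s. merge_seq (Suc n) s \<and> (\<forall>x\<in>{1..n}. c (s x) = c x)} = {id}" by simp
  then show ?case using al_id by (simp add: id_def)
next
  case (step i)
  let ?P = "\<forall>p. i < p \<longrightarrow> p \<le> n \<longrightarrow> w p < w i \<longrightarrow> c p \<noteq> c i"
  have sum_of_bool: "(\<Sum>s | A s \<and> P. f s) = of_bool P * (\<Sum>s | A s. f s)"
    for A :: "(nat \<Rightarrow> nat) \<Rightarrow> bool" and P and f :: "(nat \<Rightarrow> nat) \<Rightarrow> int"
    by (cases P) simp_all
  have i: "i \<in> {1..n}" using step.hyps step.prems by simp
  have "(\<Sum>s | merge_seq i s \<and> (\<forall>x\<in>{1..n}. c (s x) = c x). (- 1 :: int) ^ al s) =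
    (\<Sum>s | merge_seq (Suc i) s \<and> (\<forall>x\<in>{1..n}. c (s x) = c x) \<and> unmerged i (w i) c s. (- 1) ^ al s)"
    by (rule signed_sum_stage[OF i])
  also have "\<dots> = (\<Sum>s | (merge_seq (Suc i) s \<and> (\<forall>x\<in>{1..n}. c (s x) = c x)) \<and> ?P. (- 1) ^ al s)"
  proof (intro sum.cong refl Collect_cong)
    fix s
    show "merge_seq (Suc i) s \<and> (\<forall>x\<in>{1..n}. c (s x) = c x) \<and> unmerged i (w i) c s \<longleftrightarrow>
        (merge_seq (Suc i) s \<and> (\<forall>x\<in>{1..n}. c (s x) = c x)) \<and> ?P"
      using unmerged_iff[OF i, of s c] by argo
  qed
  also have "\<dots> = of_bool ?P * (\<Sum>s | merge_seq (Suc i) s \<and> (\<forall>x\<in>{1..n}. c (s x) = c x). (- 1) ^ al s)"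
    by (rule sum_of_bool)
  also have "\<dots> = of_bool (?P \<and> (\<forall>a b. Suc i \<le> a \<longrightarrow> a < b \<longrightarrow> b \<le> n \<longrightarrow> w b < w a \<longrightarrow> c b \<noteq> c a))"
    by (simp only: step.IH[OF le_SucI[OF step.prems]] of_bool_conj)
  also have "(?P \<and> (\<forall>a b. Suc i \<le> a \<longrightarrow> a < b \<longrightarrow> b \<le> n \<longrightarrow> w b < w a \<longrightarrow> c b \<noteq> c a)) \<longleftrightarrow>
      (\<forall>a b. i \<le> a \<longrightarrow> a < b \<longrightarrow> b \<le> n \<longrightarrow> w b < w a \<longrightarrow> c b \<noteq> c a)"
    (is "?P \<and> ?Q \<longleftrightarrow> ?R")
  proof
    assume PQ: "?P \<and> ?Q"
    show ?R
    proof (intro allI impI)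
      fix a b assume "i \<le> a" "a < b" "b \<le> n" "w b < w a"
      with PQ show "c b \<noteq> c a" by (cases "a = i") auto
    qed
  qed auto
  finally show ?case .
qed

lemma card_proper_colorings:
  "int (card (proper_colorings {1..n} (inversion_edges n w) k)) =
     (\<Sum>s | merge_seq 1 s. (- 1) ^ al s * int (card (invariant_colorings n k s)))"
proof -
  let ?F = "{1..n} \<rightarrow>\<^sub>E {..<k}"
  let ?proper = "\<lambda>c::nat \<Rightarrow> nat. \<forall>a b. 1 \<le> a \<longrightarrow> a < b \<longrightarrow> b \<le> n \<longrightarrow> w b < w a \<longrightarrow> c b \<noteq> c a"
  have fin: "finite ?F" by (auto intro: finite_PiE)
  have "proper_colorings {1..n} (inversion_edges n w) k = {c \<in> ?F. ?proper c}"
  proof -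
    have "(\<forall>x\<in>{1..n}. \<forall>y\<in>{1..n}. {x, y} \<in> inversion_edges n w \<longrightarrow> c x \<noteq> c y) \<longleftrightarrow> ?proper c" for c
    proof
      assume L: "\<forall>x\<in>{1..n}. \<forall>y\<in>{1..n}. {x, y} \<in> inversion_edges n w \<longrightarrow> c x \<noteq> c y"
      show "?proper c"
      proof (intro allI impI)
        fix a b assume ab: "1 \<le> a" "a < b" "b \<le> n" "w b < w a"
        then have "{a, b} \<in> inversion_edges n w"
          unfolding inversion_edges_def by (intro CollectI exI[of _ a] exI[of _ b]) auto
        then show "c b \<noteq> c a" using L ab by force
      qed
    next
      assume R: "?proper c"
      show "\<forall>x\<in>{1..n}. \<forall>y\<in>{1..n}. {x, y} \<in> inversion_edges n w \<longrightarrow> c x \<noteq> c y"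
        using R by (auto simp: inversion_edges_def doubleton_eq_iff) metis+
    qed
    then show ?thesis unfolding proper_colorings_def by blast
  qed
  then have "int (card (proper_colorings {1..n} (inversion_edges n w) k)) = (\<Sum>c\<in>?F. of_bool (?proper c))"
    using fin by (simp add: sum.If_cases of_bool_def Int_def)
  also have "\<dots> = (\<Sum>c\<in>?F. \<Sum>s | merge_seq 1 s \<and> (\<forall>x\<in>{1..n}. c (s x) = c x). (- 1) ^ al s)"
    by (intro sum.cong refl signed_sum_invariant[symmetric]) simp_all
  also have "\<dots> = (\<Sum>c\<in>?F. \<Sum>s | merge_seq 1 s. if \<forall>x\<in>{1..n}. c (s x) = c x then (- 1) ^ al s else 0)"
    by (rule sum.cong[OF refl], subst sum.inter_filter[symmetric]) simp_all
  also have "\<dots> = (\<Sum>s | merge_seq 1 s. \<Sum>c\<in>?F. if \<forall>x\<in>{1..n}. c (s x) = c x then (- 1) ^ al s else 0)"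
    by (rule sum.swap)
  also have "\<dots> = (\<Sum>s | merge_seq 1 s. (- 1) ^ al s * int (card (invariant_colorings n k s)))"
    by (rule sum.cong[OF refl], subst sum.inter_filter[OF fin, symmetric])
      (simp_all add: invariant_colorings_def)
  finally show ?thesis .
qed


section \<open>Forbidden patterns obstruct merge sequences\<close>

text \<open>A merge changes \<open>s\<close> only at \<open>i\<close> and at the preimage
  \<open>e\<close> of \<open>p\<close>. Both new values are at most \<open>w i\<close>, and a stable
  set containing \<open>e\<close> also contains \<open>i\<close>, which is to the left of
  \<open>e\<close>; so the bound survives on every stable set.\<close>

lemma merge_seq_upper:
  assumes "merge_seq i s" "C \<subseteq> {1..n}" "s ` C \<subseteq> C" "j \<in> C"
  shows "\<exists>x\<in>C. x \<le> j \<and> w (s j) \<le> w x"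
  using assms
proof (induction arbitrary: C j)
  case start
  then show ?case by auto
next
  case (descend i s)
  then show ?case by blast
next
  case (merge i s p)
  obtain K where cm: "cycle_merge n s i p K" using separable_cycle_merge[OF merge.hyps] by blast
  interpret cycle_merge n s i p K by (rule cm)
  note basic = merge_seq_basic[OF merge.hyps(1)]
  have sC: "s ` C \<subseteq> C" using merge.prems by (intro closed_unmerge)
  obtain e where e: "e \<in> K" "s e = p" "merged e = s i"
    "\<And>x. x \<noteq> e \<Longrightarrow> x \<noteq> i \<Longrightarrow> merged x = s x" using ex_pre by blast
  have old: "\<exists>x\<in>C. x \<le> j \<and> w (s j) \<le> w x" using merge.IH merge.prems(1,3) sC by blast
  consider "j = i" | "j = e" | "j \<noteq> i" "j \<noteq> e" by blast
  then show ?case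
  proof cases
    case 1
    then have "w (merged j) \<le> w i" using merge.hyps(4) basic merged_i by auto
    then show ?thesis using 1 merge.prems(3) by blast
  next
    case 2
    have C_image: "merged ` C = C"
      by (rule inj_stable_image_eq)
        (use permutes_inj[OF merged_permutes] merge.prems finite_subset[OF merge.prems(1)] in simp_all)
    have "p \<in> C" using sC merge.prems(3) 2 e(2) by auto
    then obtain x where "x \<in> C" "merged x = p" using C_image by (metis imageE)
    then have "i \<in> C" using merged_i permutes_inj[OF merged_permutes] by (metis injD)
    moreover have "e \<in> {i..n}"
      using permutes_in_image[of s "{i..n}" e] basic e(2) merge.hyps(2,3) by auto
    moreover have "w (merged j) \<le> w i" using 2 e(3) basic by simp
    ultimately show ?thesis using 2 by auto
  next
    case 3
    then show ?thesis using old e(4) by simp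
  qed
qed

lemma not_merge_seq:
  assumes C: "C \<subseteq> {1..n}" "u ` C \<subseteq> w ` C" "j \<in> C" and less: "\<And>x. x \<in> C \<Longrightarrow> x \<le> j \<Longrightarrow> w x < u j"
  shows "\<not> (merge_seq i s \<and> u = w \<circ> s)"
proof
  assume s: "merge_seq i s \<and> u = w \<circ> s"
  then have "s ` C \<subseteq> C" using C(2) by auto
  then obtain x where "x \<in> C" "x \<le> j" "w (s j) \<le> w x"
    using merge_seq_upper s C(1,3) by blast
  then show False using less s by fastforce
qed

text \<open>\<open>matches f g u l\<close>: the restriction of \<open>u\<close> to the positions \<open>f 0 < f 1 < \<dots>\<close> has one-line
  notation \<open>l\<close>, if \<open>g\<close> translates pattern values to values.\<close>

definition matches :: "(nat \<Rightarrow> nat) \<Rightarrow> (nat \<Rightarrow> nat) \<Rightarrow> (nat \<Rightarrow> nat) \<Rightarrow> nat list \<Rightarrow> bool" where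
  "matches f g u l \<longleftrightarrow> (\<forall>a<length l. u (f a) = g (l ! a))"

lemma bruhat_le_matches_swap:
  assumes u: "bruhat_le n u w" and l: "matches f g u l"
    and f: "strict_mono_on {..<length l} f" "f ` {..<length l} \<subseteq> {1..n}"
    and g: "strict_mono_on (set l) g"
    and ab: "a < b" "b < length l" "l ! b < l ! a"
  shows "\<exists>v. bruhat_le n v w \<and> matches f g v (l[a := l ! b, b := l ! a])"
proof -
  let ?v = "u \<circ> transpose (f a) (f b)"
  have fab: "f a < f b" "f a \<in> {1..n}" "f b \<in> {1..n}"
    using f ab by (auto simp: strict_mono_on_def image_subset_iff)
  have "g (l ! b) < g (l ! a)" using g ab by (auto intro: strict_mono_onD)
  then have "u (f b) < u (f a)" using l ab by (simp add: matches_def)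
  then have edge: "(?v, u) \<in> bruhat_graph n"
    using u fab by (intro bruhat_graph_swap) (auto simp: bruhat_le_def sym_group_def)
  then have "bruhat_le n ?v w"
    using u bruhat_graph_permutes[OF edge] unfolding bruhat_le_def sym_group_def
    by (auto intro: converse_rtrancl_into_rtrancl)
  moreover have "matches f g ?v (l[a := l ! b, b := l ! a])"
    unfolding matches_def
  proof (intro allI impI)
    fix c assume "c < length (l[a := l ! b, b := l ! a])"
    then have c: "c < length l" by simp
    have inj: "inj_on f {..<length l}" using f(1) by (rule strict_mono_on_imp_inj_on)
    then have "f c = f a \<longleftrightarrow> c = a" "f c = f b \<longleftrightarrow> c = b"
      using c ab by (auto dest: inj_onD)
    then show "?v (f c) = g (l[a := l ! b, b := l ! a] ! c)"
      using l c ab by (auto simp: matches_def transpose_def nth_list_update)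
  qed
  ultimately show ?thesis by blast
qed

fun swaps :: "nat list \<Rightarrow> (nat \<times> nat) list \<Rightarrow> nat list" where
  "swaps l [] = l"
| "swaps l ((a, b) # xs) = swaps (l[a := l ! b, b := l ! a]) xs"

text \<open>Each exchange must act on an inversion of the current list, so that it is a step down in
  the Bruhat order.\<close>

fun lowering :: "nat list \<Rightarrow> (nat \<times> nat) list \<Rightarrow> bool" where
  "lowering l [] \<longleftrightarrow> True"
| "lowering l ((a, b) # xs) \<longleftrightarrow> a < b \<and> b < length l \<and> l ! b < l ! a \<and>
     lowering (l[a := l ! b, b := l ! a]) xs"

lemma bruhat_le_matches_swaps:
  assumes "bruhat_le n u w" "matches f g u l" "lowering l xs"
    and "strict_mono_on {..<length l} f" "f ` {..<length l} \<subseteq> {1..n}" "strict_mono_on (set l) g"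
  shows "\<exists>v. bruhat_le n v w \<and> matches f g v (swaps l xs)"
  using assms
proof (induction l xs arbitrary: u rule: swaps.induct)
  case (1 l)
  then show ?case by auto
next
  case (2 l a b xs)
  let ?l = "l[a := l ! b, b := l ! a]"
  have ab: "a < b" "b < length l" "l ! b < l ! a" and low: "lowering ?l xs" using 2 by auto
  obtain v where v: "bruhat_le n v w" "matches f g v ?l"
    using bruhat_le_matches_swap[OF 2(2,3) 2(5,6,7) ab] by blast
  have "set ?l = set l" using ab by (simp add: set_swap)
  then show ?case using 2(1)[OF v low] 2(5,6,7) by simp
qed

lemma bruhat_le_refl: "bruhat_le n w w"
  using w by (simp add: bruhat_le_def sym_group_def)

lemma pattern_obstruction:
  assumes "\<not> avoids n w l" "lowering l xs" "distinct l"
    and A: "A \<subseteq> {..<length l}" "j \<in> A" "((!) (swaps l xs)) ` A = ((!) l) ` A"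
      "\<forall>a\<in>A. a \<le> j \<longrightarrow> l ! a < swaps l xs ! j"
    and len: "length (swaps l xs) = length l"
  shows "\<exists>u. bruhat_le n u w \<and> \<not> (\<exists>s. merge_seq 1 s \<and> u = w \<circ> s)"
proof -
  obtain f where f: "strict_mono_on {..<length l} f" "f ` {..<length l} \<subseteq> {1..n}"
    and wf: "\<And>a b. a < length l \<Longrightarrow> b < length l \<Longrightarrow> w (f a) < w (f b) \<longleftrightarrow> l ! a < l ! b"
    using assms(1) unfolding avoids_def by blast
  define g where "g = (\<lambda>v. w (f (THE a. a < length l \<and> l ! a = v)))"
  have g: "g (l ! a) = w (f a)" if "a < length l" for a
  proof -
    have "(THE b. b < length l \<and> l ! b = l ! a) = a"
      using that nth_eq_iff_index_eq[OF assms(3)] by (intro the_equality) auto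
    then show ?thesis by (simp add: g_def)
  qed
  have "strict_mono_on (set l) g"
    using wf by (intro strict_mono_onI) (auto simp: in_set_conv_nth g)
  moreover have "matches f g w l" by (simp add: matches_def g)
  ultimately obtain u where u: "bruhat_le n u w" "matches f g u (swaps l xs)"
    using bruhat_le_matches_swaps[OF bruhat_le_refl _ assms(2) f] by blast
  have uf: "u (f a) = g (swaps l xs ! a)" if "a < length l" for a
    using u(2) that len by (simp add: matches_def)
  have mem: "swaps l xs ! a \<in> (!) l ` A" if "a \<in> A" for a using A(3) that by blast
  have "\<not> (merge_seq 1 s \<and> u = w \<circ> s)" for s
  proof (rule not_merge_seq)
    show "f ` A \<subseteq> {1..n}" using f(2) A(1) by blast
    show "u ` f ` A \<subseteq> w ` f ` A"
    proof
      fix y assume "y \<in> u ` f ` A"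
      then obtain a where a: "a \<in> A" "y = u (f a)" by blast
      then obtain b where b: "b \<in> A" "swaps l xs ! a = l ! b" using mem[OF a(1)] by blast
      have "a < length l" "b < length l" using a b A(1) by auto
      then have "y = w (f b)" using a b uf g by simp
      then show "y \<in> w ` f ` A" using b by blast
    qed
    show "f j \<in> f ` A" using A(2) by blast
    fix x assume x: "x \<in> f ` A" "x \<le> f j"
    then obtain a where a: "a \<in> A" "x = f a" by blast
    have al: "a < length l" and jl: "j < length l" using a A(1,2) by auto
    have "a \<le> j"
    proof (rule ccontr)
      assume "\<not> a \<le> j"
      then have "f j < f a" using f(1) al jl by (auto intro: strict_mono_onD)
      then show False using x a by simp
    qed
    then have lt: "l ! a < swaps l xs ! j" using A(4) a by blast
    obtain b where b: "b \<in> A" "swaps l xs ! j = l ! b" using mem[OF A(2)] by blast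
    then have "b < length l" using A(1) by auto
    then show "w x < u (f j)" using lt b a al jl wf uf g by simp
  qed
  then show ?thesis using u(1) by blast
qed

lemma avoids_if_all_merge_seq:
  assumes "\<And>u. bruhat_le n u w \<Longrightarrow> \<exists>s. merge_seq 1 s \<and> u = w \<circ> s"
  shows "avoids n w [4,2,3,1]" "avoids n w [3,5,1,4,2]" "avoids n w [4,2,5,1,3]"
    "avoids n w [3,5,1,6,2,4]"
proof -
  have *: "avoids n w l"
    if "lowering l xs" "distinct l" "A \<subseteq> {..<length l}" "j \<in> A"
      "((!) (swaps l xs)) ` A = ((!) l) ` A" "\<forall>a\<in>A. a \<le> j \<longrightarrow> l ! a < swaps l xs ! j"
      "length (swaps l xs) = length l" for l xs A j
    using pattern_obstruction[OF _ that] assms by blast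
  \<comment> \<open>The exchanges end in 1324, and in the other three cases in 12435, 13245 and
    124356. On \<open>A\<close>, with positions counted from 0, the set of entries is unchanged,
    while the entry at \<open>j\<close> now exceeds all original entries of \<open>A\<close> up to
    \<open>j\<close>.\<close>
  show "avoids n w [4,2,3,1]"
    by (rule *[where xs = "[(0,1),(0,3),(1,2),(2,3)]" and A = "{1,2}" and j = 1])
      (simp_all add: eval_nat_numeral, auto?)
  show "avoids n w [3,5,1,4,2]"
    by (rule *[where xs = "[(0,2),(1,2),(1,4),(2,3),(3,4)]" and A = "{0,2,3}" and j = 2])
      (simp_all add: eval_nat_numeral, auto?)
  show "avoids n w [4,2,5,1,3]"
    by (rule *[where xs = "[(0,1),(0,3),(1,4),(2,3),(3,4)]" and A = "{1,2,4}" and j = 1])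
      (simp_all add: eval_nat_numeral, auto?)
  show "avoids n w [3,5,1,6,2,4]"
    by (rule *[where xs = "[(0,2),(1,2),(1,4),(2,5),(3,4),(4,5)]" and A = "{0,2,3,5}" and j = 2])
      (simp_all add: eval_nat_numeral, auto?)
qed


section \<open>The hull of a permutation avoiding the patterns\<close>

text \<open>For larger \<open>i\<close> the upper bound uses only positions from \<open>i\<close>
  on, in accordance with the permutations of \<open>{i..n}\<close> that occur at stage
  \<open>i\<close>.\<close>

definition in_hull :: "nat \<Rightarrow> (nat \<Rightarrow> nat) \<Rightarrow> bool" where
  "in_hull i u \<longleftrightarrow> (\<forall>j\<in>{i..n}. (\<exists>x\<in>{i..j}. u j \<le> w x) \<and> (\<exists>x\<in>{j..n}. w x \<le> u j))"

text \<open>Going down an edge, the entries at \<open>i\<close> and \<open>j\<close> trade places.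
  The upper bound at \<open>i\<close> held for the larger entry and the lower bound at
  \<open>j\<close> for the smaller one, so these two bounds serve both entries in either
  place.\<close>

lemma bruhat_le_in_hull:
  assumes "bruhat_le n u w"
  shows "in_hull 1 u"
proof -
  have "(u, w) \<in> (bruhat_graph n)\<^sup>*" using assms by (simp add: bruhat_le_def)
  then show ?thesis
  proof (induction rule: converse_rtrancl_induct)
    case base
    then show ?case by (auto simp: in_hull_def)
  next
    case (step u v)
    then obtain i j where ij: "i \<in> {1..n}" "j \<in> {1..n}" "i < j" "v = u \<circ> transpose i j" "u i < u j"
      unfolding bruhat_graph_iff by blast
    have hull: "\<exists>x\<in>{1..k}. v k \<le> w x" "\<exists>x\<in>{k..n}. w x \<le> v k" if "k \<in> {1..n}" for k
      using step.IH that by (auto simp: in_hull_def)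
    have vij: "v i = u j" "v j = u i" using ij(4) by simp_all
    show ?case unfolding in_hull_def
    proof
      fix k assume k: "k \<in> {1..n}"
      consider "k = i" | "k = j" | "k \<noteq> i" "k \<noteq> j" by blast
      then show "(\<exists>x\<in>{1..k}. u k \<le> w x) \<and> (\<exists>x\<in>{k..n}. w x \<le> u k)"
      proof cases
        case 1
        obtain x where x: "x \<in> {1..i}" "v i \<le> w x" using hull(1)[OF ij(1)] by blast
        obtain y where y: "y \<in> {j..n}" "w y \<le> v j" using hull(2)[OF ij(2)] by blast
        have "u k \<le> w x" "w y \<le> u k" using x(2) y(2) vij 1 ij(5) by auto
        moreover have "x \<in> {1..k}" "y \<in> {k..n}" using x(1) y(1) 1 ij(3) by auto
        ultimately show ?thesis by blast
      next
        case 2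
        obtain x where x: "x \<in> {1..i}" "v i \<le> w x" using hull(1)[OF ij(1)] by blast
        obtain y where y: "y \<in> {j..n}" "w y \<le> v j" using hull(2)[OF ij(2)] by blast
        have "u k \<le> w x" "w y \<le> u k" using x(2) y(2) vij 2 ij(5) by auto
        moreover have "x \<in> {1..k}" "y \<in> {k..n}" using x(1) y(1) 2 ij(3) by auto
        ultimately show ?thesis by blast
      next
        case 3
        then have "v k = u k" using ij(4) by (simp add: transpose_def)
        then show ?thesis using hull[OF k] by simp
      qed
    qed
  qed
qed

section \<open>Occurrences of the four patterns\<close>

lemma avoidsD:
  assumes "avoids n w l" "length xs = length l" "sorted_wrt (<) xs" "set xs \<subseteq> {1..n}"
    and "\<forall>a<length l. \<forall>b<length l. w (xs ! a) < w (xs ! b) \<longleftrightarrow> l ! a < l ! b"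
  shows False
proof -
  have "strict_mono_on {..<length l} ((!) xs)"
    using assms(2,3) by (intro strict_mono_onI) (simp add: sorted_wrt_iff_nth_less)
  moreover have "((!) xs) ` {..<length l} \<subseteq> {1..n}"
    by (intro image_subsetI) (use assms(2,4) in \<open>metis lessThan_iff nth_mem subsetD\<close>)
  ultimately show False using assms(1,5) unfolding avoids_def by blast
qed

lemma avoids_4231D:
  assumes "avoids n w [4,2,3,1]" "1 \<le> a" "a < b" "b < c" "c < d" "d \<le> n"
    "w d < w b" "w b < w c" "w c < w a"
  shows False
  by (rule avoidsD[OF assms(1), of "[a, b, c, d]"]) (use assms(2-) in \<open>auto simp: less_Suc_eq\<close>)

lemma avoids_35142D:
  assumes "avoids n w [3,5,1,4,2]" "1 \<le> a" "a < b" "b < c" "c < d" "d < e" "e \<le> n"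
    "w c < w e" "w e < w a" "w a < w d" "w d < w b"
  shows False
  by (rule avoidsD[OF assms(1), of "[a, b, c, d, e]"]) (use assms(2-) in \<open>auto simp: less_Suc_eq\<close>)

lemma avoids_42513D:
  assumes "avoids n w [4,2,5,1,3]" "1 \<le> a" "a < b" "b < c" "c < d" "d < e" "e \<le> n"
    "w d < w b" "w b < w e" "w e < w a" "w a < w c"
  shows False
  by (rule avoidsD[OF assms(1), of "[a, b, c, d, e]"]) (use assms(2-) in \<open>auto simp: less_Suc_eq\<close>)

lemma avoids_351624D:
  assumes "avoids n w [3,5,1,6,2,4]" "1 \<le> a" "a < b" "b < c" "c < d" "d < e" "e < f" "f \<le> n"
    "w c < w e" "w e < w a" "w a < w f" "w f < w b" "w b < w d"
  shows False
  by (rule avoidsD[OF assms(1), of "[a, b, c, d, e, f]"]) (use assms(2-) in \<open>auto simp: less_Suc_eq\<close>)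

lemma w_less_iff: "x \<noteq> y \<Longrightarrow> \<not> w x < w y \<longleftrightarrow> w y < w x"
  by (metis linorder_neqE_nat not_less_iff_gr_or_eq w_eq_iff)

lemma obtain_max:
  assumes "finite A" "A \<noteq> {}"
  obtains k where "k \<in> A" "\<And>x. x \<in> A \<Longrightarrow> w x \<le> w k"
proof -
  have "Max (w ` A) \<in> w ` A" using assms by simp
  then obtain k where k: "k \<in> A" "w k = Max (w ` A)" by auto
  then have "w x \<le> w k" if "x \<in> A" for x using that assms(1) by simp
  then show ?thesis using that k(1) by blast
qed

section \<open>Undoing merges inside the hull\<close>

text \<open>Only an upper bound can be lost when \<open>i\<close> is left out. If it fails at
  \<open>j\<close>, take \<open>k\<close> of largest value in \<open>{Suc i..j}\<close> and the set
  \<open>M\<close> of positions of larger value. Avoidance makes \<open>M\<close> stable under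
  \<open>s\<close>, but \<open>s j\<close> lies in \<open>M\<close> and \<open>j\<close> does
  not.\<close>

lemma in_hull_descend:
  assumes avoid: "avoids n w [4,2,3,1]" "avoids n w [4,2,5,1,3]"
    and i: "i \<in> {1..n}" and s: "s permutes {i..n}" and hull: "in_hull i (w \<circ> s)" and fix_i: "s i = i"
  shows "in_hull (Suc i) (w \<circ> s)"
  unfolding in_hull_def
proof (intro ballI conjI)
  fix j assume j: "j \<in> {Suc i..n}"
  have lower: "\<exists>x\<in>{t..n}. w x \<le> w (s t)" and upper: "\<exists>x\<in>{i..t}. w (s t) \<le> w x"
    if "t \<in> {i..n}" for t
    using hull that by (auto simp: in_hull_def)
  show "\<exists>x\<in>{j..n}. w x \<le> (w \<circ> s) j" using lower[of j] j by simp
  show "\<exists>x\<in>{Suc i..j}. (w \<circ> s) j \<le> w x"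
  proof (rule ccontr)
    assume contra: "\<not> ?thesis"
    obtain k where k: "k \<in> {Suc i..j}" "\<And>x. x \<in> {Suc i..j} \<Longrightarrow> w x \<le> w k"
      using j by (auto intro: obtain_max[of "{Suc i..j}"])
    define p where "p = s j"
    have big: "w x < w p" if "x \<in> {Suc i..j}" for x using contra that by (auto simp: p_def not_le)
    obtain x where "x \<in> {i..j}" "w p \<le> w x" using upper[of j] j by (auto simp: p_def)
    then have "w p \<le> w i" using big[of x] by (cases "x = i") auto
    moreover have "p \<noteq> i" using fix_i j permutes_inj[OF s] by (metis Suc_n_not_le_n atLeastAtMost_iff injD p_def)
    ultimately have pi: "w p < w i" by (simp add: order_le_less)
    have p: "p \<in> {i..n}" unfolding p_def using permutes_in_image[OF s, of j] j by simp
    have jp: "j < p"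
    proof (rule ccontr)
      assume "\<not> j < p"
      then have "p \<in> {Suc i..j}" using p \<open>p \<noteq> i\<close> by auto
      then show False using big by blast
    qed
    define M where "M = {x \<in> {i..n}. w k < w x}"
    have "s g \<in> M" if g: "g \<in> M" for g
    proof (rule ccontr)
      assume "s g \<notin> M"
      moreover have "s g \<in> {i..n}" using g permutes_in_image[OF s, of g] by (simp add: M_def)
      ultimately have sg: "w (s g) \<le> w k" by (auto simp: M_def)
      have gk: "g \<in> {i..n}" "w k < w g" using g by (auto simp: M_def)
      have "g \<noteq> i" using sg big[OF k(1)] pi fix_i by auto
      then have "j < g" using k(2)[of g] gk by fastforce
      \<comment> \<open>The lower bound at \<open>g\<close> supplies a value below
        \<open>w k\<close> further right. Then \<open>i\<close>, \<open>k\<close>, \<open>g\<close>,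
        \<open>h\<close> or \<open>i\<close>, \<open>k\<close>, \<open>p\<close>, \<open>h\<close>
        form 4231, or else \<open>i\<close>, \<open>k\<close>, \<open>g\<close>, \<open>h\<close>,
        \<open>p\<close> form 42513.\<close>
      obtain h where h: "h \<in> {g..n}" "w h \<le> w (s g)" using lower[OF gk(1)] by blast
      have "h \<noteq> g" using h(2) sg gk(2) by auto
      then have gh: "g < h" using h(1) by auto
      then have "h \<noteq> k" using k(1) \<open>j < g\<close> by auto
      then have hk: "w h < w k" using h(2) sg by (metis le_trans nat_less_le w_eq_iff)
      have kp: "w k < w p" using big[OF k(1)] .
      have pos: "1 \<le> i" "i < k" "k < g" "k < p" "h \<le> n" "p \<le> n"
        using i k(1) \<open>j < g\<close> jp h(1) p by auto
      show False
      proof (cases "w g < w i")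
        case True
        then show False using avoids_4231D[OF avoid(1) pos(1-3) gh pos(5) hk gk(2)] by blast
      next
        case False
        then have ig: "w i < w g" using w_less_iff[of g i] \<open>g \<noteq> i\<close> by simp
        have "p \<noteq> h" using kp hk by auto
        then consider "p < h" | "h < p" by linarith
        then show False
        proof cases
          case 1
          then show False using avoids_4231D[OF avoid(1) pos(1,2,4) 1 pos(5) hk kp pi] by blast
        next
          case 2
          then show False
            using avoids_42513D[OF avoid(2) pos(1-3) gh 2 pos(6) hk kp pi ig] by blast
        qed
      qed
    qed
    then have "s ` M = M"
      using permutes_inj[OF s] by (intro inj_stable_image_eq) (auto simp: M_def)
    moreover have "p \<in> M" using p big[OF k(1)] by (simp add: M_def)
    ultimately obtain x where "x \<in> M" "s x = p" by (metis imageE)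
    then have "j \<in> M" using permutes_inj[OF s] by (metis injD p_def)
    then show False using k(2)[of j] j by (auto simp: M_def)
  qed
qed

text \<open>The cycle of \<open>s\<close> is followed from \<open>p = s i\<close> until just before
  its first value above \<open>w p\<close> and at most \<open>w i\<close>, and this segment is
  closed up to a cycle of its own. The only bound in doubt afterwards is the lower one at the last
  position \<open>j\<close> of the segment, and its failure would produce 35142 or 351624.\<close>

lemma in_hull_unmerge:
  assumes avoid: "avoids n w [3,5,1,4,2]" "avoids n w [3,5,1,6,2,4]"
    and i: "i \<in> {1..n}" and s: "s permutes {i..n}" and hull: "in_hull i (w \<circ> s)" and nfix: "s i \<noteq> i"
  shows "\<exists>s0. s0 permutes {i..n} \<and> in_hull i (w \<circ> s0) \<and> i < s i \<and> s i \<le> n \<and> w (s i) < w (s0 i) \<and>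
    w (s0 i) \<le> w i \<and> separable i s0 (s i) \<and> s = transpose (s0 i) (s i) \<circ> s0"
proof -
  have lower: "\<exists>x\<in>{t..n}. w x \<le> w (s t)" and upper: "\<exists>x\<in>{i..t}. w (s t) \<le> w x"
    if "t \<in> {i..n}" for t
    using hull that by (auto simp: in_hull_def)
  define p where "p = s i"
  have p: "p \<in> {i..n}" unfolding p_def using permutes_in_image[OF s, of i] i by simp
  have "w p \<le> w i" using upper[of i] i by (simp add: p_def)
  then have pi: "w p < w i" using nfix by (simp add: order_le_less p_def)
  have ip: "i < p" using p nfix by (auto simp: p_def)
  define window where "window x \<longleftrightarrow> w p < w x \<and> w x \<le> w i" for x
  have wi: "window i" and wp: "\<not> window p" using pi by (auto simp: window_def)
  define z where "z m = (s ^^ m) p" for m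
  have z0: "z 0 = p" and zS: "z (Suc m) = s (z m)" for m by (simp_all add: z_def)
  have z: "z m \<in> {i..n}" for m
  proof (induction m)
    case 0
    then show ?case using p by (simp add: z0)
  next
    case (Suc m)
    then show ?case using permutes_in_image[OF s, of "z m"] by (simp only: zS)
  qed
  \<comment> \<open>The cycle returns to \<open>i\<close>, which lies in the window.\<close>
  have "\<exists>m. window (z m)"
  proof (rule ccontr)
    assume none: "\<not> ?thesis"
    have "s ` range z \<subseteq> range z" by (auto simp flip: zS)
    moreover have "finite (range z)" by (rule finite_subset[of _ "{i..n}"]) (use z in auto)
    ultimately have "s ` range z = range z"
      using permutes_inj[OF s] by (intro inj_stable_image_eq)
    then obtain x where "x \<in> range z" "s x = p" using z0 by (metis imageE rangeI)
    then have "i \<in> range z" using permutes_inj[OF s] by (metis injD p_def)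
    then show False using none wi by auto
  qed
  then obtain k where k: "window (z k)" "\<And>m. m < k \<Longrightarrow> \<not> window (z m)"
    using LeastI_ex[of "\<lambda>m. window (z m)"] not_less_Least[of _ "\<lambda>m. window (z m)"] by blast
  have "k \<noteq> 0" using k(1) wp z0 by (intro notI) simp
  then obtain k' where k': "k = Suc k'" by (cases k) auto
  define j q where "j = z k'" and "q = s j"
  have wq: "window q" using k(1) by (simp add: k' zS q_def j_def)
  have j: "j \<in> {i..n}" "\<not> window j" using z k(2)[of k'] by (auto simp: j_def k')
  have ji: "j \<noteq> i" using j(2) wi by auto
  have q: "q \<in> {i..n}" using permutes_in_image[OF s, of j] j by (simp add: q_def)
  define s0 where "s0 = transpose p q \<circ> s"
  have s0i: "s0 i = q" by (simp add: s0_def p_def)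
  have s0j: "s0 j = p" by (simp add: s0_def q_def)
  have s0_other: "s0 x = s x" if "x \<noteq> i" "x \<noteq> j" for x
  proof -
    have "s x \<noteq> p" "s x \<noteq> q" using that permutes_inj[OF s] by (metis injD p_def q_def)+
    then show ?thesis by (simp add: s0_def transpose_def)
  qed
  have "s0 permutes {i..n}"
    unfolding s0_def using s p q by (intro permutes_compose permutes_swap_id)
  moreover have "s = transpose (s0 i) (s i) \<circ> s0"
    unfolding s0i by (simp add: s0_def p_def transpose_commute[of q] comp_assoc[symmetric])
  moreover have "separable i s0 p"
    unfolding separable_def
  proof (intro exI conjI ballI)
    show "z ` {..<k} \<subseteq> {1..n}"
    proof (intro image_subsetI)
      fix m show "z m \<in> {1..n}" using z[of m] i by simp
    qed
    show "p \<in> z ` {..<k}" using z0 k' by force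
    show "s0 ` z ` {..<k} \<subseteq> z ` {..<k}"
    proof
      fix y assume "y \<in> s0 ` z ` {..<k}"
      then obtain m where m: "m < k" "y = s0 (z m)" by blast
      show "y \<in> z ` {..<k}"
      proof (cases "z m = j")
        case True
        then show ?thesis using m \<open>p \<in> z ` {..<k}\<close> s0j by simp
      next
        case False
        then have "m \<noteq> k'" by (auto simp: j_def)
        then have "Suc m < k" using m(1) k' by simp
        moreover have "z m \<noteq> i" using k(2)[OF m(1)] wi by metis
        then have "y = z (Suc m)" using False m(2) s0_other by (simp add: zS)
        ultimately show ?thesis by blast
      qed
    qed
    fix x assume "x \<in> z ` {..<k}"
    then show "\<not> (w p < w x \<and> w x \<le> w i)" using k(2) by (auto simp: window_def)
  qed
  moreover have "\<exists>x\<in>{j..n}. w x \<le> w p"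
  proof (rule ccontr)
    assume contra: "\<not> ?thesis"
    then have above: "w p < w x" if "x \<in> {j..n}" for x using that by (auto simp: not_le)
    have small_or_big: "w (z m) \<le> w p \<or> w i < w (z m)" if "m < k" for m
      using k(2)[OF that] by (auto simp: window_def not_le)
    have jbig: "w i < w j" using above[of j] j by (auto simp: window_def not_le)
    \<comment> \<open>The segment starts low, at \<open>p\<close>, and ends high, at
      \<open>j\<close>. The index \<open>m3\<close> marks its last low element, after which all its
      values exceed \<open>w i\<close>.\<close>
    define N where "N = {m. m \<le> k' \<and> w (z m) \<le> w p}"
    define m3 where "m3 = Max N"
    have N: "finite N" "0 \<in> N" by (auto simp: N_def z0)
    then have "m3 \<in> N" unfolding m3_def by (intro Max_in) auto
    then have m3: "m3 \<le> k'" "w (z m3) \<le> w p" by (auto simp: N_def)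
    have zbig: "w i < w (z m)" if "m3 < m" "m \<le> k'" for m
    proof -
      have "m \<notin> N" using that(1) Max_ge[OF N(1), of m] by (auto simp: m3_def)
      then show ?thesis using that(2) small_or_big[of m] k' by (auto simp: N_def)
    qed
    have "m3 \<noteq> k'" using m3(2) jbig pi by (auto simp: j_def)
    then have m3k: "Suc m3 \<le> k'" using m3 by simp
    define c where "c = z m3"
    have c: "c \<in> {i..n}" "w c \<le> w p" using z m3 by (auto simp: c_def)
    have cj: "c < j" using above[of c] c by force
    have sc: "w i < w (s c)" using zbig[of "Suc m3"] m3k by (simp add: zS c_def)
    \<comment> \<open>The largest value up to \<open>c\<close> exceeds \<open>w i\<close>, because
      the upper bound at \<open>c\<close> applies to \<open>s c\<close>.\<close>
    obtain b where b: "b \<in> {i..c}" "\<And>x. x \<in> {i..c} \<Longrightarrow> w x \<le> w b"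
      using c(1) by (auto intro: obtain_max[of "{i..c}"])
    obtain x where "x \<in> {i..c}" "w (s c) \<le> w x" using upper[OF c(1)] by blast
    then have scb: "w (s c) \<le> w b" using b(2)[of x] by simp
    have ib: "w i < w b" using sc scb by simp
    have "b \<noteq> c" "b \<noteq> i" using ib c(2) pi by auto
    then have ibc: "i < b" "b < c" using b(1) by auto
    obtain h where h: "h \<in> {j..n}" "w h \<le> w q" using lower[OF j(1)] by (auto simp: q_def)
    have ch: "w c < w h" using above[OF h(1)] c(2) by simp
    have "h \<noteq> i" using h(1) cj ibc by auto
    then have hi: "w h < w i" using h(2) wq by (metis le_trans nat_less_le w_eq_iff window_def)
    have "h \<noteq> j" using hi jbig by auto
    then have jh: "j < h" "h \<le> n" using h(1) by auto
    have i1: "1 \<le> i" using i by simp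
    show False
    proof (cases "w j < w b")
      case True
      then show False
        using avoids_35142D[OF avoid(1) i1 ibc cj jh ch hi jbig] by blast
    next
      case False
      moreover have "b \<noteq> j" using ibc cj by simp
      ultimately have bj: "w b < w j" using w_less_iff[of j b] by simp
      \<comment> \<open>The first element after \<open>c\<close> along the segment whose value
        exceeds \<open>w b\<close> comes from some \<open>g\<close>. The upper bound at
        \<open>g\<close> forces \<open>g\<close> to the right of \<open>c\<close>, and the order of
        \<open>g\<close> and \<open>h\<close> decides between the two patterns.\<close>
      then have "\<exists>m. m3 < m \<and> w b < w (z m)" using m3k by (intro exI[of _ k']) (simp add: j_def)
      then obtain m where m: "m3 < m" "w b < w (z m)"
          and least: "\<And>m'. m' < m \<Longrightarrow> \<not> (m3 < m' \<and> w b < w (z m'))"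
        using LeastI_ex[of "\<lambda>m. m3 < m \<and> w b < w (z m)"]
          not_less_Least[of _ "\<lambda>m. m3 < m \<and> w b < w (z m)"] by blast
      have mk: "m \<le> k'"
      proof (rule ccontr)
        assume "\<not> m \<le> k'"
        then show False using least[of k'] bj m3k by (simp add: j_def)
      qed
      have "m \<noteq> Suc m3" using m(2) scb by (auto simp: zS c_def)
      then obtain m' where m': "m = Suc m'" "m3 < m'" using m(1) by (cases m) auto
      define g where "g = z m'"
      have "w g \<le> w b" using least[of m'] m' by (simp add: g_def)
      have ig: "w i < w g" using zbig[of m'] m' mk by (simp add: g_def)
      have g: "g \<in> {i..n}" using z by (simp add: g_def)
      obtain y where y: "y \<in> {i..g}" "w (s g) \<le> w y" using upper[OF g] by blast
      have "w b < w y" using m(2) y(2) by (simp add: m' zS g_def)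
      then have "c < y" using b(2)[of y] y(1) by fastforce
      then have cg: "c < g" using y(1) by simp
      then have gb: "w g < w b" using \<open>w g \<le> w b\<close> ibc by (simp add: order_le_less)
      have "g \<noteq> h" using ig hi by auto
      then consider "g < h" | "h < g" by linarith
      then show False
      proof cases
        case 1
        then show False using avoids_35142D[OF avoid(1) i1 ibc cg 1 jh(2) ch hi ig gb] by blast
      next
        case 2
        moreover have "g \<le> n" using g by simp
        ultimately show False
          using avoids_351624D[OF avoid(2) i1 ibc cj jh(1) 2 _ ch hi ig gb bj] by blast
      qed
    qed
  qed
  moreover have "in_hull i (w \<circ> s0)" if pre: "\<exists>x\<in>{j..n}. w x \<le> w p"
    unfolding in_hull_def
  proof
    fix t assume t: "t \<in> {i..n}"
    consider "t = i" | "t = j" | "t \<noteq> i" "t \<noteq> j" by blast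
    then show "(\<exists>x\<in>{i..t}. (w \<circ> s0) t \<le> w x) \<and> (\<exists>x\<in>{t..n}. w x \<le> (w \<circ> s0) t)"
    proof cases
      case 1
      have "w q \<le> w i" "w p < w q" using wq by (auto simp: window_def)
      then show ?thesis using 1 p s0i t by (auto intro!: bexI[of _ i] bexI[of _ p])
    next
      case 2
      obtain x where "x \<in> {i..j}" "w q \<le> w x" using upper[OF j(1)] by (auto simp: q_def)
      moreover have "w p < w q" using wq by (auto simp: window_def)
      ultimately show ?thesis using 2 s0j pre by (auto intro!: bexI[of _ x])
    next
      case 3
      then show ?thesis using upper[OF t] lower[OF t] s0_other by simp
    qed
  qed
  ultimately show ?thesis
    using ip p wq s0i unfolding p_def window_def
    by (intro exI[of _ s0]) auto
qed

text \<open>Two nested inductions retrace the construction: unmerging raises \<open>w (s i)\<close>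
  until \<open>s\<close> fixes \<open>i\<close>, and then the argument passes to
  \<open>Suc i\<close>.\<close>

lemma in_hull_merge_seq:
  assumes avoid: "avoids n w [4,2,3,1]" "avoids n w [3,5,1,4,2]" "avoids n w [4,2,5,1,3]"
      "avoids n w [3,5,1,6,2,4]"
    and "1 \<le> i" "i \<le> Suc n" "s permutes {i..n}" "in_hull i (w \<circ> s)"
  shows "merge_seq i s"
  using assms(6,5,7,8)
proof (induction i arbitrary: s rule: inc_induct)
  case base
  then show ?case using merge_seq.start by (simp add: id_def)
next
  case (step i)
  have i: "i \<in> {1..n}" using step.hyps step.prems(1) by simp
  show ?case using step.prems(2,3)
  proof (induction "w i - w (s i)" arbitrary: s rule: less_induct)
    case less
    show ?case
    proof (cases "s i = i")
      case True
      have "s permutes {Suc i..n}"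
      proof (rule permutes_superset[OF less.prems(1)])
        fix x assume "x \<in> {i..n} - {Suc i..n}"
        then have "x = i" by auto
        then show "s x = x" using True by simp
      qed
      then have "merge_seq (Suc i) s"
        by (intro step.IH in_hull_descend[OF avoid(1,3) i less.prems True]) simp_all
      then show ?thesis using merge_seq_fixed_iff[OF i] by blast
    next
      case False
      then obtain s0 where s0: "s0 permutes {i..n}" "in_hull i (w \<circ> s0)" "i < s i" "s i \<le> n"
        "w (s i) < w (s0 i)" "w (s0 i) \<le> w i" "separable i s0 (s i)" "s = transpose (s0 i) (s i) \<circ> s0"
        using in_hull_unmerge[OF avoid(2,4) i less.prems] by blast
      have "w i - w (s0 i) < w i - w (s i)" using s0(5,6) by linarith
      then have "merge_seq i s0" using s0(1,2) by (rule less.hyps)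
      then show ?thesis using merge_seq.merge[OF _ s0(3,4,5,7)] s0(8) by metis
    qed
  qed
qed

lemma merge_seq_if_avoids:
  assumes "avoids n w [4,2,3,1]" "avoids n w [3,5,1,4,2]" "avoids n w [4,2,5,1,3]"
      "avoids n w [3,5,1,6,2,4]" and u: "bruhat_le n u w"
  shows "\<exists>s. merge_seq 1 s \<and> u = w \<circ> s"
proof -
  have u': "u permutes {1..n}" using u by (simp add: bruhat_le_def sym_group_def)
  have eq: "w \<circ> (inv w \<circ> u) = u" by (simp add: fun_eq_iff)
  have "inv w \<circ> u permutes {1..n}" using u' permutes_inv[OF w] by (rule permutes_compose)
  then have "merge_seq 1 (inv w \<circ> u)"
    using in_hull_merge_seq[OF assms(1-4), of 1] bruhat_le_in_hull[OF u] by (simp add: eq)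
  then show ?thesis using eq by metis
qed

end

section \<open>The polynomial identity\<close>

lemma indet_power: "indet ^ k = Fract ([:0, 1:] ^ k) 1"
  by (induction k) (simp_all add: indet_def One_fract_def)

lemma indet_nonzero: "indet \<noteq> 0"
  by (simp add: indet_def Zero_fract_def eq_fract)

text \<open>Powers with nonnegative coefficients cannot cancel: evaluation at 1 counts the elements
  of \<open>A\<close>.\<close>

lemma sum_indet_power_eq_0_iff:
  assumes "finite A"
  shows "(\<Sum>x\<in>A. indet ^ f x) = 0 \<longleftrightarrow> A = {}"
proof
  assume sum: "(\<Sum>x\<in>A. indet ^ f x) = 0"
  have "(\<Sum>x\<in>A. indet ^ f x) = Fract (\<Sum>x\<in>A. [:0, 1:] ^ f x) 1"
    using assms by induction (simp_all add: indet_power Zero_fract_def)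
  with sum have "(\<Sum>x\<in>A. [:0, 1:] ^ f x) = (0 :: int poly)" by (simp add: Zero_fract_def eq_fract)
  then have "poly (\<Sum>x\<in>A. [:0, 1:] ^ f x) (1 :: int) = 0" by simp
  then show "A = {}" using assms by (simp add: poly_sum)
qed simp

lemma poly_map_poly_of_int_sum:
  "poly (map_poly of_int (\<Sum>x\<in>A. monom (c x) (f x))) y = (\<Sum>x\<in>A. of_int (c x) * y ^ f x)"
  for y :: "'a :: comm_ring_1"
proof -
  have add: "map_poly of_int (p + q) = (map_poly of_int p + map_poly of_int q :: 'a poly)" for p q
    by (rule poly_eqI) (simp add: coeff_map_poly)
  show ?thesis
    by (induction A rule: infinite_finite_induct) (simp_all add: add map_poly_monom poly_monom)
qed

context sym_perm
begin

lemma inversion_chromatic_poly_eq: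
  "inversion_chromatic_poly n w = (\<Sum>s | merge_seq 1 s. monom ((- 1) ^ al s) (n - al s))"
    (is "?P = ?Q")
proof -
  \<comment> \<open>Positivity of \<open>k\<close> allows a power of \<open>k\<close> to be
    cancelled; infinitely many values still determine the polynomial.\<close>
  have "poly ?P (int k) = poly ?Q (int k)" if k: "k > 0" for k
  proof -
    have "card (invariant_colorings n k s) = k ^ (n - al s)" if s: "merge_seq 1 s" for s
    proof -
      have "k ^ (n - al s) * k ^ al s = k ^ n"
        using merge_seq_al(1)[OF s] by (simp flip: power_add)
      then show ?thesis using merge_seq_al(2)[OF s, of k] k by (metis mult_right_cancel power_not_zero less_irrefl)
    qed
    then show ?thesis
      unfolding inversion_chromatic_poly_def poly_chromatic_poly[OF finite_atLeastAtMost] card_proper_colorings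
      by (simp add: poly_sum poly_monom)
  qed
  then have "int ` {0<..} \<subseteq> {x. poly (?P - ?Q) x = 0}" by auto
  moreover have "infinite (int ` {0<..})"
    by (simp add: finite_image_iff infinite_Ioi)
  ultimately have "infinite {x. poly (?P - ?Q) x = 0}" using finite_subset by blast
  then have "?P - ?Q = 0" using poly_roots_finite by blast
  then show ?thesis by simp
qed

text \<open>The two outer powers leave \<open>(- indet) ^ al s\<close>, whose sign cancels against
  the coefficient.\<close>

lemma evaluated_chromatic_poly:
  "(- indet) ^ n * poly (map_poly of_int (inversion_chromatic_poly n w)) (- inverse indet) =
    (\<Sum>s | merge_seq 1 s. indet ^ al s)"
proof -
  have eq: "(- indet) ^ n * (of_int ((- 1) ^ al s) * (- inverse indet) ^ (n - al s)) = indet ^ al s"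
    if "merge_seq 1 s" for s
  proof -
    let ?c = "of_int ((- 1) ^ al s) :: int poly fract" and ?z = "(- inverse indet) ^ (n - al s)"
    have 1: "(- indet) ^ n = (- indet) ^ al s * (- indet) ^ (n - al s)"
      using merge_seq_al(1)[OF that] by (simp flip: power_add)
    have 2: "(- indet) ^ (n - al s) * ?z = 1"
      using indet_nonzero by (simp flip: power_mult_distrib)
    have 3: "(- indet) ^ al s * ?c = indet ^ al s"
      by (simp flip: power_mult_distrib)
    have "(- indet) ^ n * (?c * ?z) = ((- indet) ^ al s * ?c) * ((- indet) ^ (n - al s) * ?z)"
      unfolding 1 by (simp only: mult_ac)
    also have "\<dots> = indet ^ al s" by (simp only: 2 3 mult_1_right)
    finally show ?thesis .
  qed
  then show ?thesis
    unfolding inversion_chromatic_poly_eq poly_map_poly_of_int_sum sum_distrib_left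
    by (rule sum.cong[OF refl]) (simp only: mem_Collect_eq eq)
qed

text \<open>The merged permutations lie in the interval, so both sides sum the same powers over
  nested sets and agree exactly when the difference of the sets is empty.\<close>

lemma identity_iff_all_merge_seq:
  "(\<Sum>u\<in>lower_interval n w. indet ^ abs_length n u w) =
    (- indet) ^ n * poly (map_poly of_int (inversion_chromatic_poly n w)) (- inverse indet) \<longleftrightarrow>
   (\<forall>u. bruhat_le n u w \<longrightarrow> (\<exists>s. merge_seq 1 s \<and> u = w \<circ> s))"
proof -
  let ?I = "(\<lambda>s. w \<circ> s) ` {s. merge_seq 1 s}"
  have "inj_on (\<lambda>s. w \<circ> s) {s. merge_seq 1 s}"
  proof (rule inj_onI)
    fix s s' assume "w \<circ> s = w \<circ> s'"
    then have "w (s x) = w (s' x)" for x by (metis comp_apply)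
    then show "s = s'" by (simp add: fun_eq_iff)
  qed
  then have rhs: "(\<Sum>s | merge_seq 1 s. indet ^ al s) = (\<Sum>u\<in>?I. indet ^ abs_length n u w)"
    by (simp add: sum.reindex al_def)
  have sub: "?I \<subseteq> lower_interval n w"
  proof (rule image_subsetI)
    fix s assume s: "s \<in> {s. merge_seq 1 s}"
    then have "(w \<circ> s, w) \<in> (bruhat_graph n)\<^sup>*" using merge_seq_al(3) relpow_imp_rtrancl by blast
    moreover have "w \<circ> s permutes {1..n}" using s merge_seq_permutes w permutes_compose by blast
    ultimately show "w \<circ> s \<in> lower_interval n w"
      using w by (simp add: lower_interval_def bruhat_le_def sym_group_def)
  qed
  have fin: "finite (lower_interval n w)"
    by (rule finite_subset[OF _ finite_permutations[of "{1..n}"]])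
      (auto simp: lower_interval_def bruhat_le_def sym_group_def)
  have "(\<Sum>u\<in>lower_interval n w. indet ^ abs_length n u w) = (\<Sum>u\<in>?I. indet ^ abs_length n u w) \<longleftrightarrow>
      (\<Sum>u\<in>lower_interval n w - ?I. indet ^ abs_length n u w) = 0"
    using sum_diff[OF fin sub, of "\<lambda>u. indet ^ abs_length n u w"] by simp
  also have "\<dots> \<longleftrightarrow> lower_interval n w - ?I = {}"
    using fin by (intro sum_indet_power_eq_0_iff) simp
  also have "\<dots> \<longleftrightarrow> (\<forall>u. bruhat_le n u w \<longrightarrow> (\<exists>s. merge_seq 1 s \<and> u = w \<circ> s))"
    by (auto simp: lower_interval_def)
  finally show ?thesis unfolding evaluated_chromatic_poly rhs .
qed

end

theorem theorem8p1:
  fixes n :: nat and w :: "nat \<Rightarrow> nat"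
  assumes "w \<in> sym_group n"
  shows "(\<Sum>u\<in>lower_interval n w. indet ^ abs_length n u w) =
           (- indet) ^ n * poly (map_poly of_int (inversion_chromatic_poly n w)) (- inverse indet)
         \<longleftrightarrow>
         avoids n w [4,2,3,1] \<and> avoids n w [3,5,1,4,2] \<and>
         avoids n w [4,2,5,1,3] \<and> avoids n w [3,5,1,6,2,4]"
proof -
  interpret sym_perm n w using assms by unfold_locales (simp add: sym_group_def)
  show ?thesis
    unfolding identity_iff_all_merge_seq
    using avoids_if_all_merge_seq merge_seq_if_avoids by metis
qed

end
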